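(* Let $n$ be a positive integer and let $G$ be the subgraph of the grid graph induced by the nodes in a $3\times n$ rectangle. Consider the districting maps of $G$ which consist of $3$ districts, each of size $n$. Then the corresponding metagraph resulting from ReCom moves on these districting maps is connected.
   Context: The grid graph is the graph on $\mathbb{Z}^2$ in which two nodes are adjacent when they are at Euclidean distance 1 (the square lattice). The $3\times n$ rectangle is $\{(j,k) : 1\le j\le 3,\ 1\le k\le n\}$. A districting map of $G$ with $3$ districts of size $n$ is an (unlabeled) partition of the node set of $G$ into three sets, called districts, each having exactly $n$ nodes and inducing a connected subgraph of $G$. Two districts are adjacent if some edge of $G$ joins a node of one to a node of the other. A ReCom move on a districting map chooses two adjacent districts, merges them, and re-splits their union into two districts, each having exactly $n$ nodes and inducing a connected subgraph of $G$, leaving the other district unchanged (district sizes must stay exactly constant). The metagraph is the graph whose nodes are all such districting maps, with two distinct maps joined by an edge if and only if one can be obtained from the other by a single ReCom move. *)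

theory Defs
  imports
    "HOL-Analysis.Product_Vector"
    "HOL-Library.Disjoint_Sets"
    "Graph_Theory.Digraph_Component"
begin

text \<open>
  As usual in Graph_Theory, an undirected graph is a symmetric digraph: every edge is
  represented by both of its orientations. HOL itself has a topological constant
  \<open>connected\<close>, so the graph-theoretic one is written with its qualified name.
\<close>

definition grid_graph :: "(int \<times> int) pair_pre_digraph" where
  "grid_graph = \<lparr> pverts = UNIV,
     parcs = {((a, b), (c, d)).
       dist (real_of_int a, real_of_int b) (real_of_int c, real_of_int d) = 1} \<rparr>"

definition rectangle :: "nat \<Rightarrow> nat \<Rightarrow> (int \<times> int) set" where
  "rectangle m n = {1..int m} \<times> {1..int n}"

definition rectangle_graph :: "nat \<Rightarrow> nat \<Rightarrow> (int \<times> int, (int \<times> int) \<times> (int \<times> int)) pre_digraph"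
  where "rectangle_graph m n = with_proj grid_graph \<restriction> rectangle m n"

definition is_district :: "('a, 'b) pre_digraph \<Rightarrow> nat \<Rightarrow> 'a set \<Rightarrow> bool" where
  "is_district G s D \<longleftrightarrow>
     D \<subseteq> verts G \<and> card D = s \<and> Digraph_Component.connected (G \<restriction> D)"

definition districting_map :: "('a, 'b) pre_digraph \<Rightarrow> nat \<Rightarrow> nat \<Rightarrow> 'a set set \<Rightarrow> bool" where
  "districting_map G k s P \<longleftrightarrow>
     partition_on (verts G) P \<and> card P = k \<and> (\<forall>D\<in>P. is_district G s D)"

definition adjacent_districts :: "('a, 'b) pre_digraph \<Rightarrow> 'a set \<Rightarrow> 'a set \<Rightarrow> bool" where
  "adjacent_districts G A B \<longleftrightarrow> (\<exists>u\<in>A. \<exists>v\<in>B. u \<rightarrow>\<^bsub>G\<^esub> v)"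

definition recom_move :: "('a, 'b) pre_digraph \<Rightarrow> nat \<Rightarrow> 'a set set \<Rightarrow> 'a set set \<Rightarrow> bool" where
  "recom_move G s P Q \<longleftrightarrow>
     (\<exists>A\<in>P. \<exists>B\<in>P. A \<noteq> B \<and> adjacent_districts G A B \<and>
       (\<exists>A' B'. A' \<union> B' = A \<union> B \<and> A' \<inter> B' = {} \<and>
          is_district G s A' \<and> is_district G s B' \<and>
          Q = (P - {A, B}) \<union> {A', B'}))"

definition metagraph :: "('a, 'b) pre_digraph \<Rightarrow> nat \<Rightarrow> nat \<Rightarrow> 'a set set pair_pre_digraph" where
  "metagraph G k s = \<lparr> pverts = {P. districting_map G k s P},
     parcs = {(P, Q). districting_map G k s P \<and> districting_map G k s Q \<and> P \<noteq> Q \<and>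
                      (recom_move G s P Q \<or> recom_move G s Q P)} \<rparr>"

end

theory Submission
  imports Defs
begin

text \<open>It suffices to transform every districting map into the map whose districts are the three rows.
  Cells are written \<open>(j, k)\<close>, with row \<open>j \<in> {1..3}\<close> and column \<open>k \<in> {1..n}\<close>. Two maps that
  share a district are equal or joined by a move (\<open>share_imp_recom\<close>), so moves are found by
  exhibiting a splitting of the complement of one district. In particular a map that has a row
  among its districts is at most one move away from the map of rows. A district that meets both the
  first and the last column is a row. If there is none, then some district \<open>A\<close> contains the whole
  first column and avoids the last one, possibly after reversing the columns.

  Suppose that the complement of \<open>A\<close> is connected. Then \<open>A\<close> occupies an initial segment of
  row 1 and of row 3, by a planarity argument (\<open>row1_initial\<close>); say that these have lengths
  \<open>a1 \<ge> a3\<close>. If \<open>A\<close> avoids the last \<open>a1\<close> cells of row 2, then the complement of \<open>A\<close> can be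
  split such that one part \<open>C'\<close> consists of the ends of rows 1 and 2, and the complement of \<open>C'\<close>
  can be split into row 3 and the beginnings of rows 1 and 2 (\<open>straighten_to_rows\<close>). Otherwise
  \<open>A\<close> is blocked: in some column \<open>k\<close> only one cell is not in \<open>A\<close>, and more than \<open>k\<close> cells of
  the first \<open>k\<close> columns are not in \<open>A\<close> (\<open>blocked_if_not_free\<close>).

  The rest is counting. If \<open>A\<close> is blocked in column \<open>k\<close>, then a district that contains all cells
  of the first \<open>k\<close> columns outside \<open>A\<close> and reaches the last column has more than \<open>n\<close> cells.
  If both other districts meet the last column,
  this shows that \<open>A\<close> is not blocked (\<open>not_blocked_if_two_at_right\<close>). If the last column belongs
  to a single district \<open>C\<close>, then the third district \<open>B\<close> is adjacent to \<open>A\<close> or to \<open>C\<close>, and by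
  symmetry it can be taken adjacent to \<open>C\<close>. If now \<open>A\<close> is blocked, then \<open>B\<close> is also adjacent
  to \<open>A\<close> (\<open>blocked_imp_common_column\<close>), so the complement of \<open>C\<close> is connected too, and \<open>C\<close> is not
  blocked when seen from the right (\<open>not_both_blocked\<close>).\<close>

section \<open>Connectedness by closed sets\<close>

text \<open>For symmetric digraphs, connectedness says that a nonempty set of vertices closed under
  adjacency contains every vertex. In this form it can be both proved and used without paths, for
  the districts as well as for the metagraph.\<close>

lemma connected_iff_closed:
  assumes "wf_digraph G" "symmetric G"
  shows "Digraph_Component.connected G \<longleftrightarrow> verts G \<noteq> {} \<and>
    (\<forall>X. X \<subseteq> verts G \<longrightarrow> X \<noteq> {} \<longrightarrow> (\<forall>u v. u \<in> X \<longrightarrow> u \<rightarrow>\<^bsub>G\<^esub> v \<longrightarrow> v \<in> X) \<longrightarrow> X = verts G)"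
    (is "_ \<longleftrightarrow> _ \<and> ?R")
proof -
  interpret wf_digraph G by fact
  have e: "Digraph_Component.connected G \<longleftrightarrow> verts G \<noteq> {} \<and> (\<forall>u\<in>verts G. \<forall>v\<in>verts G. u \<rightarrow>\<^sup>*\<^bsub>G\<^esub> v)"
    using adj_mk_symmetric_eq[OF assms(2)]
    by (auto simp: Digraph_Component.connected_def strongly_connected_def reachable_def)
  have "(\<forall>u\<in>verts G. \<forall>v\<in>verts G. u \<rightarrow>\<^sup>*\<^bsub>G\<^esub> v) \<longleftrightarrow> ?R"
  proof
    assume a: "\<forall>u\<in>verts G. \<forall>v\<in>verts G. u \<rightarrow>\<^sup>*\<^bsub>G\<^esub> v"
    show ?R
    proof (intro allI impI)
      fix X assume X: "X \<subseteq> verts G" "X \<noteq> {}" "\<forall>u v. u \<in> X \<longrightarrow> u \<rightarrow>\<^bsub>G\<^esub> v \<longrightarrow> v \<in> X"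
      then obtain u where u: "u \<in> X" by blast
      have "v \<in> X" if "v \<in> verts G" for v
      proof -
        have "u \<rightarrow>\<^sup>*\<^bsub>G\<^esub> v" using a u X that by blast
        then show ?thesis using u
          by (induction rule: reachable_induct) (use X in auto)
      qed
      with X show "X = verts G" by blast
    qed
  next
    assume R: ?R
    show "\<forall>u\<in>verts G. \<forall>v\<in>verts G. u \<rightarrow>\<^sup>*\<^bsub>G\<^esub> v"
    proof (intro ballI)
      fix u v assume uv: "u \<in> verts G" "v \<in> verts G"
      let ?X = "{w. u \<rightarrow>\<^sup>*\<^bsub>G\<^esub> w}"
      have "?X = verts G"
        by (rule R[rule_format]) (use uv reachable_in_verts reachable_adj_trans in auto)
      then show "u \<rightarrow>\<^sup>*\<^bsub>G\<^esub> v" using uv by blast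
    qed
  qed
  with e show ?thesis by blast
qed

text \<open>Unit distance on the integer lattice, stated by coordinates.\<close>

definition grid_adj :: "int \<times> int \<Rightarrow> int \<times> int \<Rightarrow> bool" where
  "grid_adj u v \<longleftrightarrow> \<bar>fst u - fst v\<bar> + \<bar>snd u - snd v\<bar> = 1"

lemma grid_adj_sym: "grid_adj u v \<Longrightarrow> grid_adj v u"
  by (auto simp: grid_adj_def)

lemma sum_squares_eq_1_int:
  fixes x y :: int
  shows "x\<^sup>2 + y\<^sup>2 = 1 \<longleftrightarrow> \<bar>x\<bar> + \<bar>y\<bar> = 1"
proof
  assume a: "x\<^sup>2 + y\<^sup>2 = 1"
  have "x\<^sup>2 \<le> 1" "y\<^sup>2 \<le> 1"
    using a zero_le_power2[of x] zero_le_power2[of y] by linarith+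
  then have "\<bar>x\<bar> \<le> 1" "\<bar>y\<bar> \<le> 1" by (simp_all add: abs_square_le_1)
  then have "x \<in> {-1,0,1}" "y \<in> {-1,0,1}" by auto
  then show "\<bar>x\<bar> + \<bar>y\<bar> = 1" using a by auto
next
  assume "\<bar>x\<bar> + \<bar>y\<bar> = 1"
  then have "(x = 0 \<and> (y = 1 \<or> y = -1)) \<or> (y = 0 \<and> (x = 1 \<or> x = -1))" by arith
  then show "x\<^sup>2 + y\<^sup>2 = 1" by auto
qed

lemma dist_eq_1_iff_grid_adj:
  "dist (real_of_int a, real_of_int b) (real_of_int c, real_of_int d) = 1
   \<longleftrightarrow> grid_adj (a, b) (c, d)"
proof -
  have "dist (real_of_int a, real_of_int b) (real_of_int c, real_of_int d)
      = sqrt (real_of_int ((a - c)\<^sup>2 + (b - d)\<^sup>2))"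
    by (simp add: dist_Pair_Pair dist_real_def)
  also have "\<dots> = 1 \<longleftrightarrow> (a - c)\<^sup>2 + (b - d)\<^sup>2 = 1"
    by (simp only: real_sqrt_eq_1_iff of_int_eq_1_iff)
  finally show ?thesis by (simp add: sum_squares_eq_1_int grid_adj_def)
qed

text \<open>A set of cells is connected if it is nonempty and its only nonempty subset closed
  under adjacency is the set itself.\<close>

definition grid_connected :: "(int \<times> int) set \<Rightarrow> bool" where
  "grid_connected S \<longleftrightarrow> S \<noteq> {} \<and>
     (\<forall>X. X \<subseteq> S \<longrightarrow> X \<noteq> {} \<longrightarrow> (\<forall>u v. u \<in> X \<longrightarrow> v \<in> S \<longrightarrow> grid_adj u v \<longrightarrow> v \<in> X) \<longrightarrow> X = S)"

text \<open>The rectangle with three rows: the cell \<open>(j, k)\<close> lies in row \<open>j\<close> and column \<open>k\<close>.\<close>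

abbreviation rect :: "nat \<Rightarrow> (int \<times> int) set" where
  "rect n \<equiv> rectangle 3 n"

lemma verts_rectangle_graph [simp]: "verts (rectangle_graph m n) = rectangle m n"
  by (simp add: rectangle_graph_def)

lemma arcs_ends_rectangle_graph:
  "arcs_ends (rectangle_graph m n) = {(u, v). u \<in> rectangle m n \<and> v \<in> rectangle m n \<and> grid_adj u v}"
  by (auto simp: rectangle_graph_def grid_graph_def arcs_ends_conv dist_eq_1_iff_grid_adj image_iff)

lemma connected_induced_iff:
  assumes "D \<subseteq> rectangle m n"
  shows "Digraph_Component.connected (rectangle_graph m n \<restriction> D) \<longleftrightarrow> grid_connected D"
proof -
  let ?G = "rectangle_graph m n \<restriction> D"
  have ends: "arcs_ends ?G = {(u, v). u \<in> D \<and> v \<in> D \<and> grid_adj u v}"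
    using assms
    by (auto simp: rectangle_graph_def grid_graph_def arcs_ends_conv dist_eq_1_iff_grid_adj image_iff)
  have "wf_digraph ?G" by unfold_locales auto
  moreover have "symmetric ?G"
    unfolding symmetric_def ends by (auto simp: sym_def grid_adj_sym)
  moreover have "verts ?G = D" by simp
  moreover have "(\<forall>u v. u \<in> X \<longrightarrow> u \<rightarrow>\<^bsub>?G\<^esub> v \<longrightarrow> v \<in> X) \<longleftrightarrow>
      (\<forall>u v. u \<in> X \<longrightarrow> v \<in> D \<longrightarrow> grid_adj u v \<longrightarrow> v \<in> X)" if "X \<subseteq> D" for X
    unfolding ends using that by blast
  ultimately show ?thesis
    unfolding grid_connected_def by (subst connected_iff_closed) (simp_all cong: imp_cong)
qed

section \<open>Moves between maps with a common district\<close>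

text \<open>Maps of this rectangle with three districts of size \<open>n\<close>.\<close>

abbreviation dmap :: "nat \<Rightarrow> (int \<times> int) set set \<Rightarrow> bool" where
  "dmap n P \<equiv> districting_map (rectangle_graph 3 n) 3 n P"

lemma is_district_iff:
  "is_district (rectangle_graph 3 n) n D \<longleftrightarrow> D \<subseteq> rect n \<and> card D = n \<and> grid_connected D"
  by (auto simp: is_district_def connected_induced_iff)

lemma finite_rectangle [simp]: "finite (rectangle m n)"
  by (simp add: rectangle_def)

lemma mem_rect: "(j, k) \<in> rect n \<longleftrightarrow> 1 \<le> j \<and> j \<le> 3 \<and> 1 \<le> k \<and> k \<le> int n"
  by (auto simp: rectangle_def)

text \<open>The partition \<open>{A, B, C}\<close> is a districting map. Naming the districts avoids handling
  the partition as a set of sets.\<close>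

definition tri :: "nat \<Rightarrow> (int \<times> int) set \<Rightarrow> (int \<times> int) set \<Rightarrow> (int \<times> int) set \<Rightarrow> bool" where
  "tri n A B C \<longleftrightarrow> A \<union> B \<union> C = rect n \<and> A \<inter> B = {} \<and> A \<inter> C = {} \<and> B \<inter> C = {} \<and>
     card A = n \<and> card B = n \<and> card C = n \<and>
     grid_connected A \<and> grid_connected B \<and> grid_connected C"

lemma tri_distinct:
  assumes "tri n A B C" shows "A \<noteq> B" "A \<noteq> C" "B \<noteq> C"
  using assms unfolding tri_def grid_connected_def by (metis Int_absorb)+

lemma tri_dmap:
  assumes "tri n A B C" shows "dmap n {A, B, C}"
proof -
  note t = assms[unfolded tri_def] and d = tri_distinct[OF assms]
  have "\<Union>{A, B, C} = rect n" using t by (simp add: Un_assoc)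
  moreover have "disjoint {A, B, C}"
    using t by (simp add: disjoint_def Int_commute)
  moreover have "{} \<notin> {A, B, C}" using t by (auto simp: grid_connected_def)
  ultimately have "partition_on (rect n) {A, B, C}" by (simp add: partition_on_def)
  moreover have "card {A, B, C} = 3" using d by simp
  moreover have "A \<subseteq> rect n" "B \<subseteq> rect n" "C \<subseteq> rect n" using t by blast+
  ultimately show ?thesis
    using t by (simp add: districting_map_def is_district_iff)
qed

lemma dmap_triE:
  assumes "dmap n P" "A \<in> P"
  obtains B C where "P = {A, B, C}" "tri n A B C"
proof -
  have P: "partition_on (rect n) P" "card P = 3" "\<And>D. D \<in> P \<Longrightarrow> D \<subseteq> rect n \<and> card D = n \<and> grid_connected D"
    using assms by (auto simp: districting_map_def is_district_iff)
  have "card (P - {A}) = 2" using P(2) assms(2) by (simp add: card_ge_0_finite)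
  then obtain B C where BC: "P - {A} = {B, C}" "B \<noteq> C" by (auto simp: card_2_iff)
  then have PE: "P = {A, B, C}" "A \<noteq> B" "A \<noteq> C" using assms(2) by auto
  have "tri n A B C"
    using partition_onD1[OF P(1)] partition_onD2[OF P(1)] P(3) PE BC(2)
    by (auto simp: tri_def disjoint_def)
  with PE(1) show ?thesis by (rule that)
qed

text \<open>A connected set cannot meet both of two sets between which there are no edges.\<close>

lemma grid_connected_subset_union:
  assumes "grid_connected S" "S \<subseteq> B \<union> C" "B \<inter> C = {}"
    and na: "\<And>u v. u \<in> B \<Longrightarrow> v \<in> C \<Longrightarrow> \<not> grid_adj u v"
  shows "S \<subseteq> B \<or> S \<subseteq> C"
proof (cases "S \<inter> B = {}")
  case False
  have "S \<inter> B = S"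
    using assms(1)[unfolded grid_connected_def, THEN conjunct2, rule_format, of "S \<inter> B"] False
      assms(2) na by blast
  then show ?thesis by blast
qed (use assms in blast)

text \<open>Two districting maps with a common district. This symmetric relation replaces the edges of
  the metagraph.\<close>

definition share :: "nat \<Rightarrow> (int \<times> int) set set \<Rightarrow> (int \<times> int) set set \<Rightarrow> bool" where
  "share n P Q \<longleftrightarrow> dmap n P \<and> dmap n Q \<and> P \<inter> Q \<noteq> {}"

abbreviation reach :: "nat \<Rightarrow> (int \<times> int) set set \<Rightarrow> (int \<times> int) set set \<Rightarrow> bool" where
  "reach n \<equiv> (share n)\<^sup>*\<^sup>*"

text \<open>Distinct maps with a common district are joined by a move: if the two remaining districts of
  one map were not adjacent, then their union would split into connected halves in only one way, and
  the maps would coincide.\<close>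

lemma share_imp_recom:
  assumes "share n P Q" "P \<noteq> Q"
  shows "recom_move (rectangle_graph 3 n) n P Q"
proof -
  obtain A where A: "A \<in> P" "A \<in> Q" using assms by (auto simp: share_def)
  have dm: "dmap n P" "dmap n Q" using assms by (auto simp: share_def)
  obtain B C where BC: "P = {A, B, C}" "tri n A B C" by (rule dmap_triE[OF dm(1) A(1)])
  obtain B' C' where BC': "Q = {A, B', C'}" "tri n A B' C'" by (rule dmap_triE[OF dm(2) A(2)])
  have un: "B' \<union> C' = B \<union> C" using BC(2) BC'(2) unfolding tri_def by blast
  have "finite (B \<union> C)"
    using BC(2) finite_rectangle unfolding tri_def by (metis finite_Un)
  then have fin: "finite B" "finite C" by auto
  show ?thesis
  proof (cases "\<exists>u\<in>B. \<exists>v\<in>C. grid_adj u v")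
    case True
    then have "adjacent_districts (rectangle_graph 3 n) B C"
      using BC(2) unfolding adjacent_districts_def arcs_ends_rectangle_graph tri_def by blast
    moreover have "is_district (rectangle_graph 3 n) n B'" "is_district (rectangle_graph 3 n) n C'"
      using BC'(2) unfolding is_district_iff tri_def by blast+
    moreover have "B' \<inter> C' = {}" "B \<noteq> C"
      using BC'(2) tri_distinct[OF BC(2)] unfolding tri_def by blast+
    moreover have "Q = P - {B, C} \<union> {B', C'}"
      using BC(1) BC'(1) tri_distinct[OF BC(2)] by auto
    ultimately show ?thesis using un BC(1) unfolding recom_move_def by blast
  next
    case False
    have eq: "D = B \<or> D = C" if "grid_connected D" "card D = n" "D \<subseteq> B \<union> C" for D
      using grid_connected_subset_union[OF that(1,3)] False BC(2) that(2) fin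
      by (metis card_subset_eq tri_def)
    have "B' = B \<or> B' = C" "C' = B \<or> C' = C"
      by (rule eq; use BC'(2) un in \<open>simp add: tri_def; blast\<close>)+
    moreover have "B' \<noteq> C'" by (rule tri_distinct[OF BC'(2)])
    ultimately have "{B', C'} = {B, C}" by auto
    then have "P = Q" using BC(1) BC'(1) by auto
    with assms(2) show ?thesis by blast
  qed
qed

lemma share_sym: "share n P Q \<Longrightarrow> share n Q P"
  by (auto simp: share_def)

lemma connected_metagraph_if_reach:
  assumes H: "dmap n H" and r: "\<And>P. dmap n P \<Longrightarrow> reach n P H"
  shows "Digraph_Component.connected (with_proj (metagraph (rectangle_graph 3 n) 3 n))"
proof -
  let ?M = "with_proj (metagraph (rectangle_graph 3 n) 3 n)"
  have arc: "P \<rightarrow>\<^bsub>?M\<^esub> Q" if "share n P Q" "P \<noteq> Q" for P Q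
    using that share_imp_recom[OF that] by (auto simp: metagraph_def share_def)
  have "wf_digraph ?M" by unfold_locales (auto simp: metagraph_def)
  moreover have "symmetric ?M" by (auto simp: symmetric_def sym_def metagraph_def)
  moreover have "verts ?M \<noteq> {}" using H by (auto simp: metagraph_def)
  moreover have "X = verts ?M"
    if X: "X \<subseteq> verts ?M" "X \<noteq> {}" "\<forall>P Q. P \<in> X \<longrightarrow> P \<rightarrow>\<^bsub>?M\<^esub> Q \<longrightarrow> Q \<in> X" for X
  proof -
    have cl: "Q \<in> X" if "reach n P Q" "P \<in> X" for P Q
      using that by (induction rule: rtranclp_induct) (use arc X(3) in metis)+
    obtain P where P: "P \<in> X" using X(2) by blast
    then have "dmap n P" using X(1) by (auto simp: metagraph_def)
    from cl[OF r[OF this] P] have HX: "H \<in> X" .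
    have "Q \<in> X" if "dmap n Q" for Q
    proof -
      have "(share n)\<inverse>\<inverse>\<^sup>*\<^sup>* H Q" using r[OF that] by (simp add: rtranclp_conversep)
      moreover have "(share n)\<inverse>\<inverse> = share n" by (auto intro!: ext simp: share_sym)
      ultimately have "reach n H Q" by simp
      from cl[OF this HX] show ?thesis .
    qed
    with X(1) show ?thesis by (auto simp: metagraph_def)
  qed
  ultimately show ?thesis by (subst connected_iff_closed) blast+
qed

section \<open>Connected sets of cells\<close>

text \<open>Induction along the four directions: a property that spreads from cell to neighbouring cell
  inside a connected set, and holds at one cell, holds at every cell.\<close>

lemma grid_connected_induct:
  assumes "grid_connected S" "(j0, k0) \<in> S" "P j0 k0" "(j, k) \<in> S"
    and "\<And>j k. (j, k) \<in> S \<Longrightarrow> P j k \<Longrightarrow> (j + 1, k) \<in> S \<Longrightarrow> P (j + 1) k"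
    and "\<And>j k. (j, k) \<in> S \<Longrightarrow> P j k \<Longrightarrow> (j - 1, k) \<in> S \<Longrightarrow> P (j - 1) k"
    and "\<And>j k. (j, k) \<in> S \<Longrightarrow> P j k \<Longrightarrow> (j, k + 1) \<in> S \<Longrightarrow> P j (k + 1)"
    and "\<And>j k. (j, k) \<in> S \<Longrightarrow> P j k \<Longrightarrow> (j, k - 1) \<in> S \<Longrightarrow> P j (k - 1)"
  shows "P j k"
proof -
  let ?X = "{(j, k) \<in> S. P j k}"
  have "?X = S"
  proof (rule assms(1)[unfolded grid_connected_def, THEN conjunct2, rule_format])
    show "?X \<noteq> {}" using assms by blast
    fix u v assume uv: "u \<in> ?X" "v \<in> S" "grid_adj u v"
    obtain j k where u: "u = (j, k)" by (cases u)
    have "v = (j + 1, k) \<or> v = (j - 1, k) \<or> v = (j, k + 1) \<or> v = (j, k - 1)"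
      using uv(3) by (cases v) (auto simp: u grid_adj_def abs_if split: if_splits)
    with assms(5-8)[of j k] uv(1,2) u show "v \<in> ?X" by auto
  qed auto
  with assms(4) show ?thesis by blast
qed

lemma grid_connected_Un:
  assumes S: "grid_connected S" and T: "grid_connected T"
    and uv: "u \<in> S" "v \<in> T" "u = v \<or> grid_adj u v"
  shows "grid_connected (S \<union> T)"
  unfolding grid_connected_def
proof (intro conjI allI impI)
  show "S \<union> T \<noteq> {}" using uv by blast
  fix X assume X: "X \<subseteq> S \<union> T" "X \<noteq> {}"
    and cl: "\<forall>u v. u \<in> X \<longrightarrow> v \<in> S \<union> T \<longrightarrow> grid_adj u v \<longrightarrow> v \<in> X"
  have iS: "S \<subseteq> X" if "X \<inter> S \<noteq> {}"
  proof -
    have "X \<inter> S = S"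
      by (rule S[unfolded grid_connected_def, THEN conjunct2, rule_format]) (use that cl in blast)+
    then show ?thesis by blast
  qed
  have iT: "T \<subseteq> X" if "X \<inter> T \<noteq> {}"
  proof -
    have "X \<inter> T = T"
      by (rule T[unfolded grid_connected_def, THEN conjunct2, rule_format]) (use that cl in blast)+
    then show ?thesis by blast
  qed
  have "X \<inter> S \<noteq> {} \<longleftrightarrow> X \<inter> T \<noteq> {}"
    using iS iT uv cl grid_adj_sym by blast
  with iS iT X show "X = S \<union> T" by blast
qed

lemma grid_connected_cover:
  assumes S: "grid_connected S" "S \<subseteq> W"
    and c: "\<And>w. w \<in> W \<Longrightarrow> \<exists>T. grid_connected T \<and> w \<in> T \<and> T \<subseteq> W \<and> T \<inter> S \<noteq> {}"
  shows "grid_connected W"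
  unfolding grid_connected_def
proof (intro conjI allI impI)
  show "W \<noteq> {}" using S by (auto simp: grid_connected_def)
  fix X assume X: "X \<subseteq> W" "X \<noteq> {}"
    and cl: "\<forall>u v. u \<in> X \<longrightarrow> v \<in> W \<longrightarrow> grid_adj u v \<longrightarrow> v \<in> X"
  have sub: "T \<subseteq> X" if "grid_connected T" "T \<subseteq> W" "X \<inter> T \<noteq> {}" for T
  proof -
    have "X \<inter> T = T"
      by (rule that(1)[unfolded grid_connected_def, THEN conjunct2, rule_format])
        (use that cl in blast)+
    then show ?thesis by blast
  qed
  obtain w where w: "w \<in> X" using X by blast
  with X(1) have "w \<in> W" by blast
  then obtain T where T: "grid_connected T" "w \<in> T" "T \<subseteq> W" "T \<inter> S \<noteq> {}" using c by metis
  then have "T \<subseteq> X" using w by (intro sub) auto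
  then have "X \<inter> S \<noteq> {}" using T(4) by blast
  then have SX: "S \<subseteq> X" using sub S by blast
  have "x \<in> X" if xW: "x \<in> W" for x
  proof -
    obtain T where T: "grid_connected T" "x \<in> T" "T \<subseteq> W" "T \<inter> S \<noteq> {}" using c[OF xW] by blast
    then have "T \<subseteq> X" using SX by (intro sub) auto
    then show ?thesis using T(2) by blast
  qed
  with X show "X = W" by blast
qed

lemma grid_connected_row:
  assumes "a \<le> b" shows "grid_connected ({r} \<times> {a..b})"
proof -
  have "grid_connected ({r} \<times> {a..a + int m})" for m
  proof (induction m)
    case 0
    then show ?case by (auto simp: grid_connected_def)
  next
    case (Suc m)
    have e: "{r} \<times> {a..a + int (Suc m)} = {r} \<times> {a..a + int m} \<union> {(r, a + int (Suc m))}" by auto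
    have s: "grid_connected {(r, a + int (Suc m))}" by (auto simp: grid_connected_def)
    show ?case unfolding e
      by (rule grid_connected_Un[OF Suc s, of "(r, a + int m)" "(r, a + int (Suc m))"])
        (auto simp: grid_adj_def)
  qed
  from this[of "nat (b - a)"] show ?thesis using assms by simp
qed

section \<open>Symmetries\<close>

text \<open>The reflections of the rectangle that exchange rows 1 and 3, and that reverse the order of
  the columns.\<close>

definition vflip :: "int \<times> int \<Rightarrow> int \<times> int" where
  "vflip u = (4 - fst u, snd u)"

definition hflip :: "nat \<Rightarrow> int \<times> int \<Rightarrow> int \<times> int" where
  "hflip n u = (fst u, int n + 1 - snd u)"

text \<open>Involutive automorphisms of the rectangle.\<close>

definition rect_symmetry :: "nat \<Rightarrow> (int \<times> int \<Rightarrow> int \<times> int) \<Rightarrow> bool" where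
  "rect_symmetry n f \<longleftrightarrow> (\<forall>u. f (f u) = u) \<and> (\<forall>u. u \<in> rect n \<longrightarrow> f u \<in> rect n) \<and>
     (\<forall>u v. grid_adj u v \<longrightarrow> grid_adj (f u) (f v))"

lemma rect_symmetry_vflip: "rect_symmetry n vflip"
  by (auto simp: rect_symmetry_def vflip_def grid_adj_def rectangle_def)

lemma rect_symmetry_hflip: "rect_symmetry n (hflip n)"
  by (auto simp: rect_symmetry_def hflip_def grid_adj_def rectangle_def)

lemma mem_vflip: "(j, k) \<in> vflip ` S \<longleftrightarrow> (4 - j, k) \<in> S"
  by (force simp: vflip_def image_iff)

lemma mem_hflip: "(j, k) \<in> hflip n ` S \<longleftrightarrow> (j, int n + 1 - k) \<in> S"
  by (force simp: hflip_def image_iff)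

lemma symmetry_involution: "rect_symmetry n f \<Longrightarrow> f (f u) = u"
  unfolding rect_symmetry_def by blast

lemma symmetry_inj: "rect_symmetry n f \<Longrightarrow> inj f"
  by (metis injI symmetry_involution)

lemma symmetry_image_image: "rect_symmetry n f \<Longrightarrow> f ` f ` S = S"
  by (simp add: image_image symmetry_involution)

lemma symmetry_rect:
  assumes "rect_symmetry n f" shows "f ` rect n = rect n"
proof
  show s: "f ` rect n \<subseteq> rect n" using assms by (auto simp: rect_symmetry_def)
  then have "f ` f ` rect n \<subseteq> f ` rect n" by blast
  then show "rect n \<subseteq> f ` rect n" by (simp add: symmetry_image_image[OF assms])
qed

lemma symmetry_connected:
  assumes f: "rect_symmetry n f" and S: "grid_connected S"
  shows "grid_connected (f ` S)"
  unfolding grid_connected_def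
proof (intro conjI allI impI)
  show "f ` S \<noteq> {}" using S by (auto simp: grid_connected_def)
  fix X assume X: "X \<subseteq> f ` S" "X \<noteq> {}"
    and cl: "\<forall>u v. u \<in> X \<longrightarrow> v \<in> f ` S \<longrightarrow> grid_adj u v \<longrightarrow> v \<in> X"
  have ff: "f (f x) = x" for x by (rule symmetry_involution[OF f])
  have "f ` X = S"
  proof (rule S[unfolded grid_connected_def, THEN conjunct2, rule_format])
    show "f ` X \<subseteq> S" using X(1) ff by auto
    show "f ` X \<noteq> {}" using X(2) by blast
    fix u v assume uv: "u \<in> f ` X" "v \<in> S" "grid_adj u v"
    have "f u \<in> X" using uv(1) ff by auto
    moreover have "grid_adj (f u) (f v)" using f uv(3) unfolding rect_symmetry_def by blast
    ultimately have "f v \<in> X" using cl uv(2) by blast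
    then show "v \<in> f ` X" using ff[of v] by (metis imageI)
  qed
  then show "X = f ` S" using symmetry_image_image[OF f, of X] by simp
qed

lemma symmetry_tri:
  assumes f: "rect_symmetry n f" and t: "tri n A B C"
  shows "tri n (f ` A) (f ` B) (f ` C)"
proof -
  note i = symmetry_inj[OF f]
  have "f ` A \<union> f ` B \<union> f ` C = rect n"
    using t symmetry_rect[OF f] by (simp add: tri_def image_Un[symmetric])
  moreover have "f ` A \<inter> f ` B = {}" "f ` A \<inter> f ` C = {}" "f ` B \<inter> f ` C = {}"
    using t by (simp_all add: tri_def image_Int[OF i, symmetric])
  ultimately show ?thesis
    using t symmetry_connected[OF f] by (simp add: tri_def card_image[OF inj_on_subset[OF i]])
qed

lemma symmetry_dmap:
  assumes f: "rect_symmetry n f" and P: "dmap n P"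
  shows "dmap n ((`) f ` P)"
proof -
  have "P \<noteq> {}" using P by (auto simp: districting_map_def)
  then obtain A where "A \<in> P" by blast
  then obtain B C where "P = {A, B, C}" "tri n A B C" using dmap_triE[OF P] by blast
  then show ?thesis using tri_dmap[OF symmetry_tri[OF f]] by simp
qed

lemma symmetry_reach:
  assumes f: "rect_symmetry n f" and r: "reach n P Q"
  shows "reach n ((`) f ` P) ((`) f ` Q)"
  using r
proof (induction rule: rtranclp_induct)
  case (step Q R)
  have "share n ((`) f ` Q) ((`) f ` R)"
    using step(2) symmetry_dmap[OF f] by (auto simp: share_def)
  with step(3) show ?case by (rule rtranclp.rtrancl_into_rtrancl)
qed simp

section \<open>The map of rows\<close>

text \<open>Row \<open>j\<close> of the rectangle, and the map whose districts are the three rows.\<close>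

definition row :: "nat \<Rightarrow> int \<Rightarrow> (int \<times> int) set" where
  "row n j = {j} \<times> {1..int n}"

definition rows :: "nat \<Rightarrow> (int \<times> int) set set" where
  "rows n = {row n 1, row n 2, row n 3}"

lemma grid_connected_row_n: "n > 0 \<Longrightarrow> grid_connected (row n j)"
  by (simp add: row_def grid_connected_row)

lemma card_row [simp]: "card (row n j) = n"
  by (simp add: row_def card_cartesian_product)

lemma tri_rows: "n > 0 \<Longrightarrow> tri n (row n 1) (row n 2) (row n 3)"
  by (simp add: tri_def grid_connected_row_n) (auto simp: row_def rectangle_def)

lemma dmap_rows: "n > 0 \<Longrightarrow> dmap n (rows n)"
  unfolding rows_def by (rule tri_dmap[OF tri_rows])

lemma vflip_row: "vflip ` row n j = row n (4 - j)"
  by (rule set_eqI) (auto simp: mem_vflip row_def split_paired_all)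

lemma hflip_row: "hflip n ` row n j = row n j"
  by (rule set_eqI) (auto simp: mem_hflip row_def split_paired_all)

lemma vflip_rows: "(`) vflip ` rows n = rows n"
  by (auto simp: rows_def vflip_row)

lemma hflip_rows: "(`) (hflip n) ` rows n = rows n"
  by (simp add: rows_def hflip_row)

lemma reach_rows_symmetry:
  assumes f: "rect_symmetry n f" and fix_rows: "(`) f ` rows n = rows n"
    and r: "reach n {f ` A, f ` B, f ` C} (rows n)"
  shows "reach n {A, B, C} (rows n)"
  using symmetry_reach[OF f r] by (simp add: fix_rows symmetry_image_image[OF f])

lemma reach_rows_vflip:
  "reach n {vflip ` A, vflip ` B, vflip ` C} (rows n) \<Longrightarrow> reach n {A, B, C} (rows n)"
  by (rule reach_rows_symmetry[OF rect_symmetry_vflip vflip_rows])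

lemma reach_rows_hflip:
  "reach n {hflip n ` A, hflip n ` B, hflip n ` C} (rows n) \<Longrightarrow> reach n {A, B, C} (rows n)"
  by (rule reach_rows_symmetry[OF rect_symmetry_hflip hflip_rows])

lemma reach_step:
  assumes "tri n A B C" "tri n A' B' C'" "{A, B, C} \<inter> {A', B', C'} \<noteq> {}"
    and "reach n {A', B', C'} Q"
  shows "reach n {A, B, C} Q"
proof -
  have "share n {A, B, C} {A', B', C'}"
    using assms(1-3) by (simp only: share_def tri_dmap simp_thms)
  then show ?thesis using assms(4) by (rule converse_rtranclp_into_rtranclp)
qed

lemma reach_rows_if_row:
  assumes "tri n A B C" "n > 0" "row n j \<in> {A, B, C}" "j \<in> {1..3}"
  shows "reach n {A, B, C} (rows n)"
proof -
  have "j \<in> {1, 2, 3}" using assms(4) by auto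
  then have "{A, B, C} \<inter> {row n 1, row n 2, row n 3} \<noteq> {}" using assms(3) by auto
  then show ?thesis
    using reach_step[OF assms(1) tri_rows[OF assms(2)], of "rows n"] by (simp add: rows_def)
qed

lemma grid_connected_singleton: "grid_connected {u}"
  by (auto simp: grid_connected_def)

section \<open>Straightening a district at the left end\<close>

text \<open>The district \<open>A\<close> fills the first \<open>a1\<close> cells of row 1 and the first \<open>a3 \<le> a1\<close> cells of
  row 3, and it avoids the last \<open>a1\<close> cells of row 2. These last \<open>a1\<close> cells of row 2 together with
  the last \<open>n - a1\<close> cells of row 1 form a district \<open>C'\<close>, and the cells outside \<open>A\<close> and \<open>C'\<close>
  form a connected set \<open>B'\<close>, consisting of the rest of row 3 and of cells of row 2 joined to it.
  Now \<open>A \<union> B'\<close> is the complement of \<open>C'\<close>, which also splits into row 3 and the beginnings of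
  rows 1 and 2. The last assumption keeps the cells of row 2 enclosed between the two arms of
  \<open>A\<close> connected to the right.\<close>

lemma straighten_to_rows:
  assumes t: "tri n A B C"
    and row1: "\<And>k. 1 \<le> k \<Longrightarrow> (1, k) \<in> A \<longleftrightarrow> k \<le> a1"
    and row3: "\<And>k. 1 \<le> k \<Longrightarrow> (3, k) \<in> A \<longleftrightarrow> k \<le> a3"
    and a: "1 \<le> a3" "a3 \<le> a1" "a1 < int n" and c1: "(2, 1) \<in> A"
    and free: "\<And>k. k > int n - a1 \<Longrightarrow> (2, k) \<notin> A"
    and pocket: "\<And>k l. 1 \<le> k \<Longrightarrow> k < l \<Longrightarrow> l \<le> a3 + 1 \<Longrightarrow> (2, l) \<in> A \<Longrightarrow> (2, k) \<in> A"
  shows "reach n {A, B, C} (rows n)"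
proof -
  define N where "N = int n"
  have AR: "A \<subseteq> rect n" "card A = n" "finite A"
    using t finite_subset[OF _ finite_rectangle[of 3 n]] by (auto simp: tri_def)
  have inA: "(j, k) \<in> A \<Longrightarrow> 1 \<le> j \<and> j \<le> 3 \<and> 1 \<le> k \<and> k \<le> N" for j k
    using AR(1) by (auto simp: mem_rect N_def)
  have sumN: "a1 + a3 + 1 \<le> N"
  proof -
    have "card ({1} \<times> {1..a1} \<union> {3} \<times> {1..a3} \<union> {(2::int, 1::int)}) \<le> card A"
      by (rule card_mono) (use AR row1 row3 c1 in auto)
    moreover have "card ({1} \<times> {1..a1} \<union> {3} \<times> {1..a3} \<union> {(2::int, 1::int)}) = nat a1 + nat a3 + 1"
      by (subst card_Un_disjoint; (subst card_Un_disjoint)?) (auto simp: card_cartesian_product)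
    ultimately show ?thesis using AR a by (simp add: N_def)
  qed
  define C' where "C' = {1::int} \<times> {a1 + 1..N} \<union> {2::int} \<times> {N - a1 + 1..N}"
  define B' where "B' = rect n - A - C'"
  \<comment> \<open>\<open>E\<close> and row 3 make up the complement of \<open>C'\<close>.\<close>
  define E where "E = {1::int} \<times> {1..a1} \<union> {2} \<times> {1..N - a1}"
  have memC': "(j, k) \<in> C' \<longleftrightarrow> (j = 1 \<and> a1 < k \<and> k \<le> N) \<or> (j = 2 \<and> N - a1 < k \<and> k \<le> N)" for j k
    by (auto simp: C'_def)
  have C'R: "C' \<subseteq> rect n" using a by (auto simp: memC' mem_rect N_def)
  have AC': "A \<inter> C' = {}" using row1 free a by (auto simp: memC' N_def)
  have cC': "card C' = n"
    unfolding C'_def by (subst card_Un_disjoint) (use a in \<open>auto simp: card_cartesian_product N_def\<close>)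
  have cE: "card E = n"
    unfolding E_def by (subst card_Un_disjoint) (use a in \<open>auto simp: card_cartesian_product N_def\<close>)
  have cR: "card (rect n) = 3 * n" by (simp add: rectangle_def card_cartesian_product)
  have cB': "card B' = n"
  proof -
    have "card (A \<union> C') = 2 * n"
      using AC' cC' AR C'R finite_subset[OF C'R] by (simp add: card_Un_disjoint)
    moreover have "B' = rect n - (A \<union> C')" by (auto simp: B'_def)
    moreover have "card (rect n - (A \<union> C')) = card (rect n) - card (A \<union> C')"
      by (rule card_Diff_subset) (use AR C'R finite_subset[OF C'R] in auto)
    ultimately show ?thesis using cR by simp
  qed
  have conC': "grid_connected C'"
    unfolding C'_def
    by (rule grid_connected_Un[of _ _ "(1, N)" "(2, N)"])
      (use a in \<open>auto intro!: grid_connected_row simp: grid_adj_def N_def\<close>)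
  have conE: "grid_connected E"
    unfolding E_def
    by (rule grid_connected_Un[of _ _ "(1, 1)" "(2, 1)"])
      (use a in \<open>auto intro!: grid_connected_row simp: grid_adj_def N_def\<close>)
  have memB': "(j, k) \<in> B' \<longleftrightarrow> 1 \<le> k \<and> k \<le> N \<and>
      (j = 3 \<and> a3 < k \<or> j = 2 \<and> k \<le> N - a1 \<and> (2, k) \<notin> A)" for j k
  proof -
    have "1 \<le> j \<and> j \<le> 3 \<longleftrightarrow> j = 1 \<or> j = 2 \<or> j = 3" by auto
    then show ?thesis using row1[of k] row3[of k] a
      by (auto simp: B'_def memC' mem_rect N_def)
  qed
  let ?S = "{3::int} \<times> {a3 + 1..N}"
  have conS: "grid_connected ?S" by (rule grid_connected_row) (use a in \<open>simp add: N_def\<close>)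
  have conB': "grid_connected B'"
  proof (rule grid_connected_cover[OF conS])
    show "?S \<subseteq> B'" using a by (auto simp: memB')
    fix w assume w: "w \<in> B'"
    obtain j k where jk: "w = (j, k)" by (cases w)
    have Snn: "(3, a3 + 1) \<in> ?S" using a by (simp add: N_def)
    consider "j = 3" "a3 < k" | "j = 2" "a3 < k" | "j = 2" "k \<le> a3"
      using w jk by (cases "a3 < k") (auto simp: memB')
    then show "\<exists>T. grid_connected T \<and> w \<in> T \<and> T \<subseteq> B' \<and> T \<inter> ?S \<noteq> {}"
    proof cases
      case 1
      then have "w \<in> ?S" using w jk by (auto simp: memB')
      then show ?thesis using conS \<open>?S \<subseteq> B'\<close> by blast
    next
      case 2
      have "grid_connected ({2} \<times> {k..k} \<union> {3} \<times> {k..k})"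
        by (rule grid_connected_Un[of _ _ "(2, k)" "(3, k)"])
          (auto simp: grid_connected_singleton grid_adj_def)
      moreover have "{2} \<times> {k..k} \<union> {3} \<times> {k..k} \<subseteq> B'"
        using w 2 jk by (auto simp: memB')
      moreover have "(3, k) \<in> ?S" using 2 w jk by (auto simp: memB')
      ultimately show ?thesis using jk 2 by (intro exI[of _ "{2} \<times> {k..k} \<union> {3} \<times> {k..k}"]) auto
    next
      case 3
      \<comment> \<open>Between the two arms of \<open>A\<close> the path runs along row 2 up to the end of the shorter
        arm, and there descends to row 3.\<close>
      let ?T = "{2} \<times> {k..a3 + 1} \<union> {3} \<times> {a3 + 1..a3 + 1}"
      have k: "1 \<le> k" "(2, k) \<notin> A" using w jk 3 by (auto simp: memB')
      have "grid_connected ?T"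
        by (rule grid_connected_Un[of _ _ "(2, a3 + 1)" "(3, a3 + 1)"])
          (use 3 in \<open>auto intro!: grid_connected_row simp: grid_connected_singleton grid_adj_def\<close>)
      moreover have "?T \<subseteq> B'"
      proof -
        have "(2, l) \<notin> A" if "k \<le> l" "l \<le> a3 + 1" for l
          using pocket[of k l] k that by (cases "k = l") auto
        then show ?thesis using k sumN a by (auto simp: memB' N_def)
      qed
      ultimately show ?thesis using jk 3 Snn by (intro exI[of _ ?T]) auto
    qed
  qed
  have t1: "tri n A B' C'"
    using t AC' C'R cC' cB' conC' conB' AR unfolding tri_def B'_def by blast
  have n0: "n > 0" using a by simp
  have memE: "(j, k) \<in> E \<longleftrightarrow> (j = 1 \<and> 1 \<le> k \<and> k \<le> a1) \<or> (j = 2 \<and> 1 \<le> k \<and> k \<le> N - a1)" for j k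
    by (auto simp: E_def)
  have memR: "(j, k) \<in> row n i \<longleftrightarrow> j = i \<and> 1 \<le> k \<and> k \<le> N" for i j k
    by (auto simp: row_def N_def)
  have "E \<union> row n 3 \<union> C' = rect n"
  proof (rule set_eqI)
    fix w :: "int \<times> int"
    obtain j k where jk: "w = (j, k)" by (cases w)
    have "1 \<le> j \<and> j \<le> 3 \<longleftrightarrow> j = 1 \<or> j = 2 \<or> j = 3" by auto
    then show "w \<in> E \<union> row n 3 \<union> C' \<longleftrightarrow> w \<in> rect n"
      using a by (auto simp: jk memE memR memC' mem_rect N_def)
  qed
  moreover have "E \<inter> row n 3 = {}" "E \<inter> C' = {}" "row n 3 \<inter> C' = {}"
    by (auto simp: memE memR memC')
  ultimately have t2: "tri n E (row n 3) C'"
    using cE cC' conE conC' grid_connected_row_n[OF n0] by (simp add: tri_def)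
  have "reach n {E, row n 3, C'} (rows n)"
    by (rule reach_rows_if_row[OF t2 n0, of 3]) auto
  then have "reach n {A, B', C'} (rows n)"
    by (rule reach_step[OF t1 t2, rotated]) auto
  then show ?thesis
    by (rule reach_step[OF t t1, rotated]) auto
qed

section \<open>Column counts\<close>

text \<open>Number of cells of \<open>S\<close> in column \<open>k\<close>; integer-valued so that sums can be subtracted.\<close>

definition col_count :: "(int \<times> int) set \<Rightarrow> int \<Rightarrow> int" where
  "col_count S k = int (card {j. (j, k) \<in> S})"

text \<open>The district \<open>A\<close> is blocked at column \<open>k\<close> if it leaves a single cell of that column free
  and more than \<open>k\<close> cells of the first \<open>k\<close> columns, that is, if it has fewer than \<open>2 * k\<close> of the
  latter. The free cell of column \<open>k\<close> then separates a large part of the complement on its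
  left from the part on its right.\<close>

definition blocked :: "(int \<times> int) set \<Rightarrow> nat \<Rightarrow> bool" where
  "blocked A n \<longleftrightarrow> (\<exists>k. 1 \<le> k \<and> k \<le> int n \<and> col_count A k = 2 \<and> (\<Sum>i=1..k. col_count A i) < 2 * k)"

lemma finite_col: "S \<subseteq> rect n \<Longrightarrow> finite {j. (j, k) \<in> S}"
  by (rule finite_subset[of _ "{1..3}"]) (auto simp: rectangle_def)

lemma sum_col_count:
  assumes "S \<subseteq> rect n"
  shows "(\<Sum>i=a..b. col_count S i) = int (card {(j, i). (j, i) \<in> S \<and> a \<le> i \<and> i \<le> b})"
proof -
  have "{(j, i). (j, i) \<in> S \<and> a \<le> i \<and> i \<le> b} = prod.swap ` (SIGMA i:{a..b}. {j. (j, i) \<in> S})"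
    by (auto simp: image_iff)
  then have "card {(j, i). (j, i) \<in> S \<and> a \<le> i \<and> i \<le> b} = card (SIGMA i:{a..b}. {j. (j, i) \<in> S})"
    by (simp add: card_image)
  also have "\<dots> = (\<Sum>i\<in>{a..b}. card {j. (j, i) \<in> S})"
    using finite_col[OF assms] by (intro card_SigmaI) auto
  finally show ?thesis by (simp add: col_count_def)
qed

lemma col_count_vflip: "col_count (vflip ` S) k = col_count S k"
proof -
  have "{j. (j, k) \<in> vflip ` S} = (\<lambda>j. 4 - j) ` {j. (j, k) \<in> S}"
    by (rule set_eqI) (auto simp: mem_vflip intro: image_eqI[of _ _ "4 - _"])
  then show ?thesis by (simp add: col_count_def card_image inj_on_def)
qed

lemma col_count_hflip: "col_count (hflip n ` S) k = col_count S (int n + 1 - k)"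
  by (simp add: col_count_def mem_hflip)

section \<open>The shape of a district at the left end\<close>

text \<open>A connected set \<open>A\<close> with connected complement that contains the first column and avoids the
  last one.\<close>

locale left_district =
  fixes n :: nat and A :: "(int \<times> int) set"
  assumes sub: "A \<subseteq> rect n"
    and conA: "grid_connected A"
    and conU: "grid_connected (rect n - A)"
    and left: "\<And>j. 1 \<le> j \<Longrightarrow> j \<le> 3 \<Longrightarrow> (j, 1) \<in> A"
    and right: "\<And>j. (j, int n) \<notin> A"
begin

lemma in_A: "(j, k) \<in> A \<Longrightarrow> 1 \<le> j \<and> j \<le> 3 \<and> 1 \<le> k \<and> k < int n"
  using sub right by (metis mem_rect order_le_less subsetD)

lemma n_gt_1: "1 < int n"
  using in_A[OF left[of 1]] by simp

abbreviation "U \<equiv> rect n - A"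

lemma in_U: "(j, k) \<in> U \<longleftrightarrow> 1 \<le> j \<and> j \<le> 3 \<and> 1 \<le> k \<and> k \<le> int n \<and> (j, k) \<notin> A"
  by (auto simp: mem_rect)

text \<open>No nonempty part of the complement is closed under adjacency unless it reaches the last
  column.\<close>

lemma closed_in_U_False:
  assumes "(j0, k0) \<in> U" "P j0 k0" "\<not> P 1 (int n)"
    and "\<And>j k. (j, k) \<in> U \<Longrightarrow> P j k \<Longrightarrow> (j + 1, k) \<in> U \<Longrightarrow> P (j + 1) k"
    and "\<And>j k. (j, k) \<in> U \<Longrightarrow> P j k \<Longrightarrow> (j - 1, k) \<in> U \<Longrightarrow> P (j - 1) k"
    and "\<And>j k. (j, k) \<in> U \<Longrightarrow> P j k \<Longrightarrow> (j, k + 1) \<in> U \<Longrightarrow> P j (k + 1)"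
    and "\<And>j k. (j, k) \<in> U \<Longrightarrow> P j k \<Longrightarrow> (j, k - 1) \<in> U \<Longrightarrow> P j (k - 1)"
  shows False
proof -
  have "(1, int n) \<in> U" unfolding in_U using n_gt_1 right by simp
  from grid_connected_induct[OF conU assms(1,2) this assms(4-7)] assms(3) show False by blast
qed

text \<open>If \<open>A\<close> contains a path from row 3 to row 1 that runs along row 2 between the columns \<open>m\<close>
  and \<open>l\<close>, then everything to the left of the path belongs to \<open>A\<close>, since the complement
  is connected and reaches the last column. Only the part in row 1 is recorded.\<close>

lemma cut:
  assumes "(3, m) \<in> A" "(1, l) \<in> A"
    and mid: "\<And>i. min m l \<le> i \<Longrightarrow> i \<le> max m l \<Longrightarrow> (2, i) \<in> A"
    and k: "1 \<le> k" "k < l"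
  shows "(1, k) \<in> A"
proof (rule ccontr)
  assume nk: "(1, k) \<notin> A"
  \<comment> \<open>\<open>P\<close> describes the cells to the left of the path.\<close>
  define P where "P j i \<longleftrightarrow> (j = 1 \<and> i < l) \<or> (j = 2 \<and> i < min m l) \<or> (j = 3 \<and> i < m)" for j i :: int
  have mid': "(2, i) \<notin> U" if "min m l \<le> i" "i \<le> max m l" for i using mid[OF that] by simp
  have ends: "(3, m) \<notin> U" "(1, l) \<notin> U" using assms by auto
  have "l < int n" using in_A assms(2) by blast
  show False
  proof (rule closed_in_U_False[of 1 k P])
    show "(1, k) \<in> U" unfolding in_U using nk k \<open>l < int n\<close> by simp
    show "P 1 k" using k by (simp add: P_def)
    show "\<not> P 1 (int n)" using \<open>l < int n\<close> by (simp add: P_def)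
  next
    fix j i assume a: "P j i" "(j + 1, i) \<in> U"
    consider "j = 1" "i < l" | "j = 2" "i < min m l" | "j = 3" using a(1) by (auto simp: P_def)
    then show "P (j + 1) i"
    proof cases
      case 1
      then have "i < min m l" using mid'[of i] a(2) by force
      then show ?thesis using 1 by (simp add: P_def)
    qed (use a in \<open>auto simp: P_def mem_rect\<close>)
  next
    fix j i assume a: "P j i" "(j - 1, i) \<in> U"
    consider "j = 3" "i < m" | "j = 2" "i < min m l" | "j = 1" using a(1) by (auto simp: P_def)
    then show "P (j - 1) i"
    proof cases
      case 1
      then have "i < min m l" using mid'[of i] a(2) by force
      then show ?thesis using 1 by (simp add: P_def)
    qed (use a in \<open>auto simp: P_def mem_rect\<close>)
  next
    fix j i assume a: "P j i" "(j, i + 1) \<in> U"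
    have "j = 1 \<Longrightarrow> i + 1 \<noteq> l" "j = 3 \<Longrightarrow> i + 1 \<noteq> m" using a(2) ends by auto
    moreover have "j = 2 \<Longrightarrow> i + 1 \<noteq> min m l" using a(2) mid'[of "min m l"] by auto
    ultimately show "P j (i + 1)" using a(1) unfolding P_def by linarith
  next
    fix j i assume a: "P j i" "(j, i - 1) \<in> U"
    then show "P j (i - 1)" by (auto simp: P_def)
  qed
qed

text \<open>A discrete form of planarity: \<open>A\<close> occupies an initial segment of row 1. Otherwise a cell of
  the complement in row 1 has a cell of \<open>A\<close> further right in the same row, and the connection of
  the latter to the first column either descends to row 3, which is excluded by the lemma above,
  or passes below the cell of the complement and rises again, which isolates this cell.\<close>

lemma row1_initial:
  assumes l: "(1, l) \<in> A" and k: "1 \<le> k" "k < l"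
  shows "(1, k) \<in> A"
proof (rule ccontr)
  assume nk: "(1, k) \<notin> A"
  \<comment> \<open>\<open>P\<close> describes the cells in row 1 beyond column \<open>k\<close>, and the cells linked to one of these
    along row 2. It is closed under adjacency in \<open>A\<close> but misses the cell \<open>(1, 1)\<close>.\<close>
  define P where "P j i \<longleftrightarrow> (j = 1 \<and> i > k) \<or>
    (j = 2 \<and> (\<exists>i'>k. (1, i') \<in> A \<and> (\<forall>m. min i i' \<le> m \<and> m \<le> max i i' \<longrightarrow> (2, m) \<in> A)))" for j i :: int
  have "P 1 1"
  proof (rule grid_connected_induct[OF conA l, where P = P and j = 1 and k = 1])
    show "P 1 l" using k by (simp add: P_def)
    show "(1, 1) \<in> A" using left by simp
  next
    fix j i assume a: "(j, i) \<in> A" "P j i" "(j + 1, i) \<in> A"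
    consider "j = 1" "i > k" | "j = 2" using a(2) by (auto simp: P_def)
    then show "P (j + 1) i"
    proof cases
      case 1
      then show ?thesis using a by (auto simp: P_def intro!: exI[of _ i])
    next
      case 2
      then obtain i' where i': "i' > k" "(1, i') \<in> A"
        "\<And>m. min i i' \<le> m \<Longrightarrow> m \<le> max i i' \<Longrightarrow> (2, m) \<in> A" using a(2) by (auto simp: P_def)
      have "(3, i) \<in> A" using a(3) 2 by simp
      from cut[OF this i'(2) i'(3)] k i'(1) nk show ?thesis by blast
    qed
  next
    fix j i assume a: "(j, i) \<in> A" "P j i" "(j - 1, i) \<in> A"
    consider "j = 1" | "j = 2" using a(2) by (auto simp: P_def)
    then show "P (j - 1) i"
    proof cases
      case 1
      then show ?thesis using in_A[OF a(3)] by simp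
    next
      case 2
      then obtain i' where i': "i' > k" "(1, i') \<in> A"
        "\<And>m. min i i' \<le> m \<Longrightarrow> m \<le> max i i' \<Longrightarrow> (2, m) \<in> A" using a(2) by (auto simp: P_def)
      have iA: "(1, i) \<in> A" using a(3) 2 by simp
      have "i > k"
      proof (rule ccontr)
        assume "\<not> i > k"
        then have "i < k" using iA nk by (cases "i = k") auto
        \<comment> \<open>The cells of row 1 strictly between columns \<open>i\<close> and \<open>i'\<close> are enclosed by \<open>A\<close>.\<close>
        show False
        proof (rule closed_in_U_False[of 1 k "\<lambda>j m. j = 1 \<and> i < m \<and> m < i'"])
          show "(1, k) \<in> U" unfolding in_U using nk k in_A[OF l] by simp
          show "1 = (1::int) \<and> i < k \<and> k < i'" using \<open>i < k\<close> i' by simp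
          show "\<not> (1 = (1::int) \<and> i < int n \<and> int n < i')" using in_A[OF i'(2)] by simp
        next
          fix j m assume "j = 1 \<and> i < m \<and> m < i'" "(j + 1, m) \<in> U"
          then show "j + 1 = 1 \<and> i < m \<and> m < i'" using i'(3)[of m] by auto
        next
          fix j m assume "j = 1 \<and> i < m \<and> m < i'" "(j - 1, m) \<in> U"
          then show "j - 1 = 1 \<and> i < m \<and> m < i'" by (auto simp: mem_rect)
        next
          fix j m assume h: "j = 1 \<and> i < m \<and> m < i'" "(j, m + 1) \<in> U"
          then have "m + 1 \<noteq> i'" using i'(2) by auto
          then show "j = 1 \<and> i < m + 1 \<and> m + 1 < i'" using h by auto
        next
          fix j m assume h: "j = 1 \<and> i < m \<and> m < i'" "(j, m - 1) \<in> U"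
          then have "m - 1 \<noteq> i" using iA by auto
          then show "j = 1 \<and> i < m - 1 \<and> m - 1 < i'" using h by auto
        qed
      qed
      then show ?thesis using 2 by (simp add: P_def)
    qed
  next
    fix j i assume a: "(j, i) \<in> A" "P j i" "(j, i + 1) \<in> A"
    consider "j = 1" "i > k" | "j = 2" using a(2) by (auto simp: P_def)
    then show "P j (i + 1)"
    proof cases
      case 2
      then obtain i' where i': "i' > k" "(1, i') \<in> A"
        "\<And>m. min i i' \<le> m \<Longrightarrow> m \<le> max i i' \<Longrightarrow> (2, m) \<in> A" using a(2) by (auto simp: P_def)
      have "(2, m) \<in> A" if "min (i + 1) i' \<le> m" "m \<le> max (i + 1) i'" for m
        using i'(3)[of m] a(3) 2 that by (cases "m = i + 1") auto
      with 2 i' show ?thesis by (auto simp: P_def)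
    qed (simp add: P_def)
  next
    fix j i assume a: "(j, i) \<in> A" "P j i" "(j, i - 1) \<in> A"
    consider "j = 1" "i > k" | "j = 2" using a(2) by (auto simp: P_def)
    then show "P j (i - 1)"
    proof cases
      case 1
      then have "i - 1 \<noteq> k" using a(3) nk by auto
      then show ?thesis using 1 by (simp add: P_def)
    next
      case 2
      then obtain i' where i': "i' > k" "(1, i') \<in> A"
        "\<And>m. min i i' \<le> m \<Longrightarrow> m \<le> max i i' \<Longrightarrow> (2, m) \<in> A" using a(2) by (auto simp: P_def)
      have "(2, m) \<in> A" if "min (i - 1) i' \<le> m" "m \<le> max (i - 1) i'" for m
        using i'(3)[of m] a(3) 2 that by (cases "m = i - 1") auto
      with 2 i' show ?thesis by (auto simp: P_def)
    qed
  qed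
  then show False using k by (simp add: P_def)
qed

lemma left_district_vflip: "left_district n (vflip ` A)"
proof
  show "vflip ` A \<subseteq> rect n"
    using sub symmetry_rect[OF rect_symmetry_vflip] by (metis image_mono)
  show "grid_connected (vflip ` A)" by (rule symmetry_connected[OF rect_symmetry_vflip conA])
  have "rect n - vflip ` A = vflip ` (rect n - A)"
    using symmetry_rect[OF rect_symmetry_vflip, of n] symmetry_inj[OF rect_symmetry_vflip]
    by (metis image_set_diff)
  then show "grid_connected (rect n - vflip ` A)"
    using symmetry_connected[OF rect_symmetry_vflip conU] by simp
  show "(j, 1) \<in> vflip ` A" if "1 \<le> j" "j \<le> 3" for j
    using left[of "4 - j"] that by (simp add: mem_vflip)
  show "(j, int n) \<notin> vflip ` A" for j using right by (simp add: mem_vflip)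
qed

lemma row3_initial:
  assumes l: "(3, l) \<in> A" and k: "1 \<le> k" "k < l"
  shows "(3, k) \<in> A"
  using left_district.row1_initial[OF left_district_vflip, of l k] assms by (simp add: mem_vflip)

lemma initial_interval:
  assumes j: "1 \<le> j" "j \<le> 3"
    and ini: "\<And>k l. (j, l) \<in> A \<Longrightarrow> 1 \<le> k \<Longrightarrow> k < l \<Longrightarrow> (j, k) \<in> A"
  obtains a where "1 \<le> a" "a < int n" "\<And>k. 1 \<le> k \<Longrightarrow> (j, k) \<in> A \<longleftrightarrow> k \<le> a"
proof -
  let ?K = "{k. (j, k) \<in> A}"
  have fin: "finite ?K" by (rule finite_subset[of _ "{1..int n}"]) (use in_A in fastforce)+
  have one: "1 \<in> ?K" using left j by simp
  let ?a = "Max ?K"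
  have mx: "?a \<in> ?K" using fin one by (intro Max_in) auto
  show ?thesis
  proof (rule that[of ?a])
    show "1 \<le> ?a" using fin one by (rule Max_ge)
    show "?a < int n" using mx in_A by blast
    show "(j, k) \<in> A \<longleftrightarrow> k \<le> ?a" if "1 \<le> k" for k
      using ini[of ?a k] mx that Max_ge[OF fin, of k] by (cases "k = ?a") auto
  qed
qed

text \<open>As far as the column after the end of the shorter arm, the cells of \<open>A\<close> in row 2 form an initial
  segment, because the complement lies between the two arms there and is connected to the right only
  along row 2.\<close>

lemma row2_initial_in_pocket:
  assumes row1: "\<And>k. 1 \<le> k \<Longrightarrow> (1, k) \<in> A \<longleftrightarrow> k \<le> a1"
    and row3: "\<And>k. 1 \<le> k \<Longrightarrow> (3, k) \<in> A \<longleftrightarrow> k \<le> a3"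
    and a: "a3 \<le> a1"
    and l: "(2, l) \<in> A" "l \<le> a3 + 1" and k: "1 \<le> k" "k < l"
  shows "(2, k) \<in> A"
proof (rule ccontr)
  assume nk: "(2, k) \<notin> A"
  show False
  proof (rule closed_in_U_False[of 2 k "\<lambda>j i. j = 2 \<and> i < l"])
    show "(2, k) \<in> U" unfolding in_U using nk k in_A[OF l(1)] by simp
  next
    fix j i assume "(j, i) \<in> U" "j = 2 \<and> i < l" "(j + 1, i) \<in> U"
    then show "j + 1 = 2 \<and> i < l" using row3[of i] l(2) by (auto simp: mem_rect)
  next
    fix j i assume "(j, i) \<in> U" "j = 2 \<and> i < l" "(j - 1, i) \<in> U"
    then show "j - 1 = 2 \<and> i < l" using row1[of i] l(2) a by (auto simp: mem_rect)
  next
    fix j i assume h: "j = 2 \<and> i < l" "(j, i + 1) \<in> U"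
    then have "i + 1 \<noteq> l" using l(1) by auto
    then show "j = 2 \<and> i + 1 < l" using h by simp
  qed (use k in auto)
qed

text \<open>Beyond both arms \<open>A\<close> lies in row 2 alone and is connected to the left along this row.\<close>

lemma row2_contiguous_beyond:
  assumes row1: "\<And>k. 1 \<le> k \<Longrightarrow> (1, k) \<in> A \<longleftrightarrow> k \<le> a1"
    and row3: "\<And>k. 1 \<le> k \<Longrightarrow> (3, k) \<in> A \<longleftrightarrow> k \<le> a3"
    and a: "a3 \<le> a1"
    and l: "(2, l) \<in> A" and k: "a1 \<le> k" "k \<le> l"
  shows "(2, k) \<in> A"
proof (rule ccontr)
  assume nk: "(2, k) \<notin> A"
  then have kl: "k < l" using k l by (cases "k = l") auto
  have "1 = (2::int) \<and> k < 1"
  proof (rule grid_connected_induct[OF conA l, where P = "\<lambda>j i. j = 2 \<and> k < i" and j = 1 and k = 1])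
    show "2 = (2::int) \<and> k < l" using kl by simp
    show "(1, 1) \<in> A" using left by simp
  next
    fix j i assume h: "j = 2 \<and> k < i" "(j + 1, i) \<in> A"
    then have "(3, i) \<in> A" by simp
    then have False using row3[of i] h(1) a k in_A by force
    then show "j + 1 = 2 \<and> k < i" ..
  next
    fix j i assume h: "j = 2 \<and> k < i" "(j - 1, i) \<in> A"
    then have "(1, i) \<in> A" by simp
    then have False using row1[of i] h(1) a k in_A by force
    then show "j - 1 = 2 \<and> k < i" ..
  next
    fix j i assume h: "j = 2 \<and> k < i" "(j, i - 1) \<in> A"
    then have "i - 1 \<noteq> k" using nk by auto
    then show "j = 2 \<and> k < i - 1" using h by simp
  qed auto
  then show False by simp
qed

text \<open>If \<open>A\<close> meets the last \<open>a1\<close> cells of row 2, and \<open>m\<close> is its last column in row 2, then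
  it is blocked at \<open>k = min a1 m\<close>: it has two cells in column \<open>k\<close>, and beyond this column it has
  at least \<open>(a1 - k) + (m - k)\<close> cells, whose number exceeds \<open>n - 2 * k\<close>.\<close>

lemma blocked_if_not_free:
  assumes row1: "\<And>k. 1 \<le> k \<Longrightarrow> (1, k) \<in> A \<longleftrightarrow> k \<le> a1"
    and row3: "\<And>k. 1 \<le> k \<Longrightarrow> (3, k) \<in> A \<longleftrightarrow> k \<le> a3"
    and a: "1 \<le> a3" "a3 \<le> a1"
    and cA: "card A = n" and l: "(2, l) \<in> A" "l > int n - a1"
  shows "blocked A n"
proof -
  let ?K = "{k. (2, k) \<in> A}"
  have finK: "finite ?K" by (rule finite_subset[of _ "{1..int n}"]) (use in_A in fastforce)+
  have finA: "finite A" using sub finite_rectangle by (rule finite_subset)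
  define m where "m = Max ?K"
  have m: "(2, m) \<in> A" using Max_in[OF finK] l(1) unfolding m_def by blast
  have ml: "m > int n - a1" using Max_ge[OF finK, of l] l unfolding m_def by simp
  have m1: "1 \<le> m" using in_A[OF m] by simp
  define k where "k = min a1 m"
  have k2: "(2, k) \<in> A"
  proof (cases "m \<le> a1")
    case True then show ?thesis using m by (simp add: k_def)
  next
    case False
    then show ?thesis using row2_contiguous_beyond[OF row1 row3 a(2) m, of a1] by (simp add: k_def)
  qed
  \<comment> \<open>Otherwise row 2 is filled up to column \<open>m\<close>, so \<open>A\<close> has at least \<open>a1 + a3 + m > n\<close> cells.\<close>
  have ka3: "a3 < k"
  proof (rule ccontr)
    assume "\<not> a3 < k"
    then have ka: "k \<le> a3" by simp
    have r2: "(2, i) \<in> A" if "1 \<le> i" "i \<le> m" for i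
    proof (cases "i < k")
      case True
      then show ?thesis using row2_initial_in_pocket[OF row1 row3 a(2) k2, of i] ka that by simp
    next
      case False
      show ?thesis
      proof (cases "m \<le> a1")
        case True
        then have "i = m" using False that by (simp add: k_def)
        then show ?thesis using m by simp
      next
        case m: False
        then have "a1 \<le> i" using False by (simp add: k_def)
        then show ?thesis using row2_contiguous_beyond[OF row1 row3 a(2) \<open>(2, m) \<in> A\<close>] that by simp
      qed
    qed
    have "card ({1} \<times> {1..a1} \<union> {3} \<times> {1..a3} \<union> {2::int} \<times> {1..m}) \<le> card A"
      by (rule card_mono[OF finA]) (use r2 row1 row3 in auto)
    moreover have "card ({1} \<times> {1..a1} \<union> {3} \<times> {1..a3} \<union> {2::int} \<times> {1..m}) = nat a1 + nat a3 + nat m"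
      by (subst card_Un_disjoint; (subst card_Un_disjoint)?) (auto simp: card_cartesian_product)
    ultimately show False using cA ml a m1 by simp
  qed
  have k1: "1 \<le> k" "k \<le> int n" using in_A[OF k2] by auto
  have "(j, k) \<in> A \<longleftrightarrow> j \<in> {1, 2}" for j
  proof -
    have "1 \<le> j \<and> j \<le> 3 \<longleftrightarrow> j = 1 \<or> j = 2 \<or> j = 3" by auto
    then show ?thesis using in_A[of j k] k2 row1[of k] row3[of k] ka3 k1 by (auto simp: k_def)
  qed
  then have "{j. (j, k) \<in> A} = {1, 2}" by blast
  then have two: "col_count A k = 2" by (simp add: col_count_def)
  let ?L = "{(j, i). (j, i) \<in> A \<and> 1 \<le> i \<and> i \<le> k}"
  let ?R = "{1} \<times> {k + 1..a1} \<union> {2::int} \<times> {k + 1..m}"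
  have "?R \<subseteq> A"
  proof -
    have "(2, i) \<in> A" if "k + 1 \<le> i" "i \<le> m" for i
      by (rule row2_contiguous_beyond[OF row1 row3 a(2) m]) (use that in \<open>auto simp: k_def min_def split: if_splits\<close>)
    moreover have "(1, i) \<in> A" if "k + 1 \<le> i" "i \<le> a1" for i using row1[of i] that k1 by simp
    ultimately show ?thesis by auto
  qed
  then have "card (?L \<union> ?R) \<le> card A" using finA by (intro card_mono) auto
  moreover have finL: "finite ?L" using finA by (rule finite_subset[rotated]) auto
  have "card (?L \<union> ?R) = card ?L + card ?R"
    by (rule card_Un_disjoint) (use finL in auto)
  moreover have "card ?R = nat (a1 - k) + nat (m - k)"
    by (subst card_Un_disjoint) (auto simp: card_cartesian_product)
  moreover have "k \<le> a1" "k \<le> m" by (auto simp: k_def)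
  ultimately have "int (card ?L) < 2 * k" using cA ml by simp
  then have "(\<Sum>i=1..k. col_count A i) < 2 * k" by (simp add: sum_col_count[OF sub])
  with two k1 show ?thesis unfolding blocked_def by blast
qed

lemma straight_or_blocked_oriented:
  assumes t: "tri n A B C"
    and row1: "\<And>k. 1 \<le> k \<Longrightarrow> (1, k) \<in> A \<longleftrightarrow> k \<le> a1"
    and row3: "\<And>k. 1 \<le> k \<Longrightarrow> (3, k) \<in> A \<longleftrightarrow> k \<le> a3"
    and a: "1 \<le> a3" "a3 \<le> a1" "a1 < int n"
  shows "reach n {A, B, C} (rows n) \<or> blocked A n"
proof (cases "\<exists>k > int n - a1. (2, k) \<in> A")
  case True
  have "card A = n" using t by (simp add: tri_def)
  with True show ?thesis using blocked_if_not_free[OF row1 row3 a(1,2)] by blast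
next
  case False
  have "(2, 1) \<in> A" using left by simp
  have "reach n {A, B, C} (rows n)"
    by (rule straighten_to_rows[OF t row1 row3 a \<open>(2, 1) \<in> A\<close>])
      (use False row2_initial_in_pocket[OF row1 row3 a(2)] in auto)
  then show ?thesis ..
qed

text \<open>The reflection exchanging rows 1 and 3 makes the arm in row 1 the longer one.\<close>

lemma straight_or_blocked:
  assumes t: "tri n A B C"
  shows "reach n {A, B, C} (rows n) \<or> blocked A n"
proof -
  obtain a1 where a1: "1 \<le> a1" "a1 < int n" "\<And>k. 1 \<le> k \<Longrightarrow> (1, k) \<in> A \<longleftrightarrow> k \<le> a1"
    by (rule initial_interval[of 1]) (use row1_initial in auto)
  obtain a3 where a3: "1 \<le> a3" "a3 < int n" "\<And>k. 1 \<le> k \<Longrightarrow> (3, k) \<in> A \<longleftrightarrow> k \<le> a3"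
    by (rule initial_interval[of 3]) (use row3_initial in auto)
  show ?thesis
  proof (cases "a3 \<le> a1")
    case True
    then show ?thesis using straight_or_blocked_oriented[OF t a1(3) a3(3)] a1 a3 by blast
  next
    case False
    interpret F: left_district n "vflip ` A" by (rule left_district_vflip)
    have "reach n {vflip ` A, vflip ` B, vflip ` C} (rows n) \<or> blocked (vflip ` A) n"
      by (rule F.straight_or_blocked_oriented[OF symmetry_tri[OF rect_symmetry_vflip t], of a3 a1])
        (use a1 a3 False in \<open>auto simp: mem_vflip\<close>)
    then have "reach n {vflip ` A, vflip ` B, vflip ` C} (rows n) \<or> blocked A n"
      by (simp only: blocked_def col_count_vflip)
    then show ?thesis using reach_rows_vflip by blast
  qed
qed

end

section \<open>Numerical consequences of being blocked\<close>

text \<open>The properties of the column counts of the three districts that the counting arguments use: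
  each column has three cells, each district has \<open>N\<close> cells, and the columns met by a district form
  an interval.\<close>

definition profile :: "int \<Rightarrow> (int \<Rightarrow> int) \<Rightarrow> (int \<Rightarrow> int) \<Rightarrow> (int \<Rightarrow> int) \<Rightarrow> bool" where
  "profile N a b c \<longleftrightarrow> (\<forall>k. 1 \<le> k \<longrightarrow> k \<le> N \<longrightarrow> a k + b k + c k = 3) \<and>
     (\<forall>f\<in>{a, b, c}. (\<forall>k. 0 \<le> f k) \<and> (\<Sum>k=1..N. f k) = N \<and>
        (\<forall>x y z. x < y \<longrightarrow> y < z \<longrightarrow> 0 < f x \<longrightarrow> 0 < f z \<longrightarrow> 0 < f y))"

lemma profile_total: "profile N a b c \<Longrightarrow> 1 \<le> k \<Longrightarrow> k \<le> N \<Longrightarrow> a k + b k + c k = 3"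
  by (simp add: profile_def)

lemma profile_nonneg:
  assumes "profile N a b c" shows "0 \<le> a k" "0 \<le> b k" "0 \<le> c k"
  using assms by (simp_all add: profile_def)

lemma profile_sum:
  assumes "profile N a b c" shows "sum a {1..N} = N" "sum b {1..N} = N" "sum c {1..N} = N"
  using assms by (simp_all add: profile_def)

lemma profile_convex:
  assumes "profile N a b c" "x \<le> y" "y \<le> z"
  shows "0 < a x \<Longrightarrow> 0 < a z \<Longrightarrow> 0 < a y" "0 < b x \<Longrightarrow> 0 < b z \<Longrightarrow> 0 < b y"
    "0 < c x \<Longrightarrow> 0 < c z \<Longrightarrow> 0 < c y"
proof -
  have "x = y \<or> y = z \<or> x < y \<and> y < z" using assms by linarith
  then show "0 < a x \<Longrightarrow> 0 < a z \<Longrightarrow> 0 < a y" "0 < b x \<Longrightarrow> 0 < b z \<Longrightarrow> 0 < b y"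
    "0 < c x \<Longrightarrow> 0 < c z \<Longrightarrow> 0 < c y"
    using assms(1) unfolding profile_def by blast+
qed

lemma profile_swap: "profile N a b c \<Longrightarrow> profile N a c b"
  by (simp add: profile_def) (simp add: algebra_simps)

lemma sum_reverse_int:
  fixes f :: "int \<Rightarrow> int"
  shows "(\<Sum>i=1..k. f (N + 1 - i)) = (\<Sum>i=N + 1 - k..N. f i)"
  by (rule sum.reindex_bij_witness[of _ "\<lambda>i. N + 1 - i" "\<lambda>i. N + 1 - i"]) auto

lemma profile_reverse:
  assumes "profile N a b c"
  shows "profile N (\<lambda>i. c (N + 1 - i)) (\<lambda>i. b (N + 1 - i)) (\<lambda>i. a (N + 1 - i))"
proof -
  have cv: "\<And>x y z. x < y \<Longrightarrow> y < z \<Longrightarrow> 0 < f (N + 1 - x) \<Longrightarrow> 0 < f (N + 1 - z) \<Longrightarrow> 0 < f (N + 1 - y)"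
    if "f \<in> {a, b, c}" for f
    using assms that unfolding profile_def by (smt (verit, best))
  have "a (N + 1 - k) + b (N + 1 - k) + c (N + 1 - k) = 3" if "1 \<le> k" "k \<le> N" for k
    using profile_total[OF assms, of "N + 1 - k"] that by simp
  moreover have "(\<Sum>k=1..N. f (N + 1 - k)) = N" if "f \<in> {a, b, c}" for f
    using profile_sum[OF assms] that by (auto simp: sum_reverse_int)
  ultimately show ?thesis
    using cv profile_nonneg[OF assms] unfolding profile_def by (simp add: algebra_simps)
qed

lemma sum_split_int:
  fixes f :: "int \<Rightarrow> int"
  assumes "x \<le> k + 1" "k \<le> y"
  shows "sum f {x..y} = sum f {x..k} + sum f {k + 1..y}"
proof -
  have "{x..y} = {x..k} \<union> {k + 1..y}" using assms by auto
  then show ?thesis by (simp add: sum.union_disjoint)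
qed

lemma sum_ge_length:
  fixes f :: "int \<Rightarrow> int"
  assumes "\<And>i. x \<le> i \<Longrightarrow> i \<le> y \<Longrightarrow> 1 \<le> f i" "x \<le> y + 1"
  shows "y + 1 - x \<le> sum f {x..y}"
proof -
  have "(\<Sum>i\<in>{x..y}. (1::int)) \<le> sum f {x..y}" by (rule sum_mono) (use assms in auto)
  then show ?thesis using assms(2) by simp
qed

lemma profile_sum_prefix:
  assumes "profile N a b c" "1 \<le> k" "k \<le> N"
  shows "sum a {1..k} + sum b {1..k} + sum c {1..k} = 3 * k"
proof -
  have "(\<Sum>i=1..k. a i + b i + c i) = (\<Sum>i=1..k. 3)"
    by (rule sum.cong) (use profile_total[OF assms(1)] assms in auto)
  then show ?thesis using assms by (simp add: sum.distrib)
qed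

text \<open>If the district \<open>c\<close> owned everything that \<open>a\<close> leaves free in the first \<open>k\<close> columns, which is more
  than \<open>k\<close> cells, and extended from there to the last column, then it would have more than \<open>N\<close>
  cells.\<close>

lemma blocked_overfull:
  assumes p: "profile N a b c" and k: "1 \<le> k" "k \<le> N"
    and bl: "sum a {1..k} < 2 * k"
    and c: "0 < c k" "0 < c N" and b: "\<And>i. 1 \<le> i \<Longrightarrow> i \<le> k \<Longrightarrow> b i = 0"
  shows False
proof -
  have "sum b {1..k} = 0" by (rule sum.neutral) (use b in auto)
  then have "sum c {1..k} > k" using profile_sum_prefix[OF p k] bl by simp
  moreover have "N + 1 - (k + 1) \<le> sum c {k + 1..N}"
  proof (rule sum_ge_length)
    show "1 \<le> c i" if "k + 1 \<le> i" "i \<le> N" for i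
      using profile_convex(3)[OF p, of k i N] c that by simp
  qed (use k in simp)
  moreover have "sum c {1..N} = sum c {1..k} + sum c {k + 1..N}"
    by (rule sum_split_int) (use k in auto)
  ultimately show False using profile_sum(3)[OF p] by simp
qed

lemma not_blocked_if_two_at_right:
  assumes p: "profile N a b c" and k: "1 \<le> k" "k \<le> N"
    and bl: "a k = 2" "sum a {1..k} < 2 * k" and bc: "0 < b N" "0 < c N"
  shows False
proof -
  have *: False if p: "profile N a b c" and c: "c k = 1" and b: "b k = 0" "0 < b N" "0 < c N" for b c
  proof (rule blocked_overfull[OF p k bl(2)])
    fix i assume "1 \<le> i" "i \<le> k"
    then have "\<not> 0 < b i" using profile_convex(2)[OF p, of i k N] b k by auto
    then show "b i = 0" using profile_nonneg(2)[OF p, of i] by simp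
  qed (use c b in auto)
  have "b k + c k = 1" using profile_total[OF p k] bl by simp
  then have "b k = 0 \<and> c k = 1 \<or> c k = 0 \<and> b k = 1"
    using profile_nonneg(2,3)[OF p, of k] by linarith
  then show False using *[OF p] *[OF profile_swap[OF p]] bc by blast
qed

text \<open>The single free cell of the blocked column belongs either to the district \<open>b\<close> or to the district
  \<open>c\<close> that reaches the last column; in the latter case, some of \<open>b\<close> lies to the left of it.\<close>

lemma blocked_cases:
  assumes p: "profile N a b c" and k: "1 \<le> k" "k \<le> N"
    and bl: "a k = 2" "sum a {1..k} < 2 * k" and c: "0 < c N"
  obtains "b k = 1" "c k = 0" | i where "c k = 1" "b k = 0" "1 \<le> i" "i < k" "0 < b i"
proof -
  have "b k + c k = 1" using profile_total[OF p k] bl by simp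
  then have "b k = 0 \<and> c k = 1 \<or> c k = 0 \<and> b k = 1"
    using profile_nonneg(2,3)[OF p, of k] by linarith
  moreover have "\<exists>i. 1 \<le> i \<and> i < k \<and> 0 < b i" if "b k = 0" "c k = 1"
  proof (rule ccontr)
    assume n: "\<nexists>i. 1 \<le> i \<and> i < k \<and> 0 < b i"
    show False
    proof (rule blocked_overfull[OF p k bl(2)])
      fix i assume i: "1 \<le> i" "i \<le> k"
      then have "\<not> 0 < b i" using n that by (cases "i = k") auto
      then show "b i = 0" using profile_nonneg(2)[OF p, of i] by simp
    qed (use that c in auto)
  qed
  ultimately show ?thesis using that by blast
qed

lemma sum_lt_if_le_1:
  fixes f :: "int \<Rightarrow> int"
  assumes "\<And>i. 1 \<le> i \<Longrightarrow> i \<le> N \<Longrightarrow> f i \<le> 1" "f 1 = 0" "1 \<le> N"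
  shows "sum f {1..N} < N"
proof -
  have "sum f {1..N} = sum f {1..1} + sum f {1 + 1..N}"
    by (rule sum_split_int) (use assms in auto)
  also have "sum f {1 + 1..N} \<le> (\<Sum>i\<in>{1 + 1..N}. 1)" by (rule sum_mono) (use assms in auto)
  finally show ?thesis using assms by simp
qed

text \<open>If \<open>a\<close> is blocked, then some column is shared by \<open>a\<close> and \<open>b\<close> alone, which makes them
  adjacent.\<close>

lemma blocked_imp_common_column:
  assumes p: "profile N a b c" and k: "1 \<le> k" "k \<le> N"
    and bl: "a k = 2" "sum a {1..k} < 2 * k" and a1: "a 1 = 3" and c: "0 < c N"
  shows "\<exists>i. 1 \<le> i \<and> i \<le> N \<and> 0 < a i \<and> 0 < b i \<and> c i = 0"
  using p k bl c
proof (cases rule: blocked_cases)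
  case 1
  then show ?thesis using k bl by (intro exI[of _ k]) auto
next
  case (2 i0)
  show ?thesis
  proof (rule ccontr)
    assume n: "\<not> ?thesis"
    have "b i \<le> 1" if i: "1 \<le> i" "i \<le> N" for i
    proof (cases "i < k")
      case True
      then have "0 < a i" using profile_convex(1)[OF p, of 1 i k] a1 bl i by simp
      then have "b i \<le> 0 \<or> 0 < c i" using n i profile_nonneg(3)[OF p, of i] by force
      then show ?thesis using profile_total[OF p i] \<open>0 < a i\<close> by linarith
    next
      case False
      then show ?thesis using profile_convex(2)[OF p, of i0 k i] 2 by force
    qed
    moreover have "b 1 = 0"
      using profile_total[OF p, of 1] profile_nonneg(2,3)[OF p, of 1] a1 k by simp
    ultimately have "sum b {1..N} < N" using k by (intro sum_lt_if_le_1) auto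
    then show False using profile_sum(2)[OF p] by simp
  qed
qed

text \<open>With \<open>a\<close> owning the first column and \<open>c\<close> the last one, \<open>a\<close> blocked at \<open>k\<close> and \<open>c\<close>
  blocked, from the right, at \<open>l\<close> would force the middle district \<open>b\<close> to have more or fewer than
  \<open>N\<close> cells, or to leave out a column between two of its columns.\<close>

lemma not_both_blocked:
  assumes p: "profile N a b c" and a1: "a 1 = 3" and cN: "c N = 3"
    and k: "1 \<le> k" "k \<le> N" and bl: "a k = 2" "sum a {1..k} < 2 * k"
    and l: "1 \<le> l" "l \<le> N" and bl': "c l = 2" "sum c {l..N} < 2 * (N + 1 - l)"
  shows False
proof -
  note p' = profile_reverse[OF p]
  have N1: "1 \<le> N" using k by simp
  have aP: "0 < a i" if "1 \<le> i" "i \<le> k" for i using profile_convex(1)[OF p that] a1 bl by simp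
  have cP: "0 < c i" if "l \<le> i" "i \<le> N" for i using profile_convex(3)[OF p that] cN bl' by simp
  have b1: "b 1 = 0" using profile_total[OF p, of 1] profile_nonneg(2,3)[OF p, of 1] a1 N1 by simp
  have left: "b k = 1 \<and> c k = 0 \<or> (\<exists>i<k. b k = 0 \<and> 0 < b i)"
    by (rule blocked_cases[OF p k bl]) (use cN in auto)
  have right: "b l = 1 \<and> a l = 0 \<or> (\<exists>i>l. b l = 0 \<and> 0 < b i)"
  proof (rule blocked_cases[OF p', of "N + 1 - l"])
    show "(\<Sum>i=1..N + 1 - l. c (N + 1 - i)) < 2 * (N + 1 - l)"
      using bl' by (simp add: sum_reverse_int)
  next
    fix i assume "b (N + 1 - (N + 1 - l)) = 0" "i < N + 1 - l" "0 < b (N + 1 - i)"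
    then show "b l = 1 \<and> a l = 0 \<or> (\<exists>i>l. b l = 0 \<and> 0 < b i)"
      by (intro disjI2 exI[of _ "N + 1 - i"]) auto
  qed (use l bl' a1 in auto)
  consider (mm) "b k = 1" "c k = 0" "b l = 1" "a l = 0"
    | (mr) i where "b k = 1" "c k = 0" "l < i" "b l = 0" "0 < b i"
    | (lm) i where "i < k" "b k = 0" "0 < b i" "b l = 1" "a l = 0"
    | (lr) i i' where "i < k" "b k = 0" "0 < b i" "l < i'" "b l = 0" "0 < b i'"
    using left right by blast
  then show False
  proof cases
    case mm
    \<comment> \<open>Here \<open>b\<close> owns all free cells at both ends and joins them, which takes at least \<open>N + 2\<close>
      cells.\<close>
    have kl: "k < l" using aP[of l] mm l by force
    have "sum c {1..k} = 0"
    proof (rule sum.neutral, rule ballI)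
      fix i assume "i \<in> {1..k}"
      then have "\<not> 0 < c i" using profile_convex(3)[OF p, of i k N] mm k cN by auto
      then show "c i = 0" using profile_nonneg(3)[OF p, of i] by simp
    qed
    then have s1: "k < sum b {1..k}" using profile_sum_prefix[OF p k] bl by simp
    have "sum a {l..N} = 0"
    proof (rule sum.neutral, rule ballI)
      fix i assume "i \<in> {l..N}"
      then have "\<not> 0 < a i" using profile_convex(1)[OF p, of 1 l i] mm l a1 by auto
      then show "a i = 0" using profile_nonneg(1)[OF p, of i] by simp
    qed
    then have s3: "N + 1 - l < sum b {l..N}"
      using profile_sum_prefix[OF p', of "N + 1 - l"] l bl' by (simp add: sum_reverse_int)
    have s2: "(l - 1) + 1 - (k + 1) \<le> sum b {k + 1..l - 1}"
    proof (rule sum_ge_length)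
      show "1 \<le> b i" if "k + 1 \<le> i" "i \<le> l - 1" for i
        using profile_convex(2)[OF p, of k i l] mm that by simp
    qed (use kl in simp)
    have "sum b {1..N} = sum b {1..k} + sum b {k + 1..N}"
      by (rule sum_split_int) (use k in auto)
    moreover have "sum b {k + 1..N} = sum b {k + 1..l - 1} + sum b {l - 1 + 1..N}"
      by (rule sum_split_int) (use kl l in auto)
    ultimately show False using s1 s2 s3 profile_sum(2)[OF p] by simp
  next
    case mr
    then have "k < l" using cP[of k] k by force
    then show False using profile_convex(2)[OF p, of k l i] mr by simp
  next
    case lm
    then have "k < l" using aP[of l] l by force
    then show False using profile_convex(2)[OF p, of i k l] lm by simp
  next
    case lr
    \<comment> \<open>Here \<open>b\<close> lies strictly between \<open>l\<close> and \<open>k\<close>, where \<open>a\<close> and \<open>c\<close> leave at most one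
      cell per column.\<close>
    have "b j \<le> 1" if j: "1 \<le> j" "j \<le> N" for j
    proof -
      consider "j \<le> l" | "k \<le> j" | "l < j" "j < k" by linarith
      then show ?thesis
      proof cases
        case 1
        then show ?thesis using profile_convex(2)[OF p, of j l i'] lr by force
      next
        case 2
        then show ?thesis using profile_convex(2)[OF p, of i k j] lr by force
      next
        case 3
        then show ?thesis using aP[of j] cP[of j] profile_total[OF p j] j by simp
      qed
    qed
    then have "sum b {1..N} < N" using b1 N1 by (intro sum_lt_if_le_1)
    then show False using profile_sum(2)[OF p] by simp
  qed
qed

section \<open>Every map reaches the map of rows\<close>

lemma col_count_pos_iff:
  assumes "S \<subseteq> rect n" shows "0 < col_count S k \<longleftrightarrow> (\<exists>j. (j, k) \<in> S)"
  using finite_col[OF assms, of k] by (auto simp: col_count_def card_gt_0_iff)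

lemma col_count_3:
  assumes "S \<subseteq> rect n" "\<And>j. 1 \<le> j \<Longrightarrow> j \<le> 3 \<Longrightarrow> (j, k) \<in> S"
  shows "col_count S k = 3"
proof -
  have "{j. (j, k) \<in> S} = {1..3}" using assms by (auto simp: rectangle_def)
  then show ?thesis by (simp add: col_count_def)
qed

lemma col_convex:
  assumes "grid_connected S" "(j, x) \<in> S" "(j', z) \<in> S" "x < y" "y < z"
  shows "\<exists>i. (i, y) \<in> S"
proof (rule ccontr)
  assume n: "\<nexists>i. (i, y) \<in> S"
  have "z < y"
  proof (rule grid_connected_induct[OF assms(1,2), where P = "\<lambda>j k. k < y"])
    fix j k assume "(j, k + 1) \<in> S" "k < y"
    then show "k + 1 < y" using n by (cases "k + 1 = y") auto
  qed (use assms in auto)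
  then show False using assms by simp
qed

lemma tri_subsets:
  assumes "tri n A B C" shows "A \<subseteq> rect n" "B \<subseteq> rect n" "C \<subseteq> rect n"
  using assms unfolding tri_def by blast+

lemma district_profile:
  assumes "S \<subseteq> rect n" "card S = n" "grid_connected S"
  shows "(\<forall>k. 0 \<le> col_count S k) \<and> (\<Sum>k=1..int n. col_count S k) = int n \<and>
    (\<forall>x y z. x < y \<longrightarrow> y < z \<longrightarrow> 0 < col_count S x \<longrightarrow> 0 < col_count S z \<longrightarrow> 0 < col_count S y)"
proof -
  have "{(j, i). (j, i) \<in> S \<and> 1 \<le> i \<and> i \<le> int n} = S" using assms(1) by (auto simp: rectangle_def)
  then have "(\<Sum>k=1..int n. col_count S k) = int n" by (simp add: sum_col_count[OF assms(1)] assms(2))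
  then show ?thesis
    using col_convex[OF assms(3)] by (auto simp: col_count_pos_iff[OF assms(1)]) (simp add: col_count_def)
qed

lemma tri_profile:
  assumes t: "tri n A B C"
  shows "profile (int n) (col_count A) (col_count B) (col_count C)"
proof -
  have "col_count A k + col_count B k + col_count C k = 3" if k: "1 \<le> k" "k \<le> int n" for k
  proof -
    let ?F = "\<lambda>S. {j. (j, k) \<in> S}"
    have fin: "finite (?F A)" "finite (?F B)" "finite (?F C)"
      using finite_col[OF tri_subsets(1)[OF t]] finite_col[OF tri_subsets(2)[OF t]]
        finite_col[OF tri_subsets(3)[OF t]] by blast+
    have "?F A \<union> ?F B \<union> ?F C = ?F (A \<union> B \<union> C)" by blast
    also have "\<dots> = {1..3}" using t k by (auto simp: tri_def rectangle_def)
    finally have u: "?F A \<union> ?F B \<union> ?F C = {1..3}" .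
    have "card (?F A \<union> ?F B \<union> ?F C) = card (?F A) + card (?F B) + card (?F C)"
      using fin t by (subst card_Un_disjoint; (subst card_Un_disjoint)?) (auto simp: tri_def)
    then show ?thesis unfolding u by (simp add: col_count_def)
  qed
  moreover have "card A = n" "card B = n" "card C = n"
    "grid_connected A" "grid_connected B" "grid_connected C"
    using t unfolding tri_def by blast+
  ultimately show ?thesis
    using tri_subsets[OF t] district_profile[of _ n] unfolding profile_def by blast
qed

lemma tri_perm:
  assumes "tri n A B C" shows "tri n A C B" "tri n B A C" "tri n C B A"
  using assms unfolding tri_def by (simp_all add: Un_ac Int_commute)

lemma tri_cell:
  assumes "tri n A B C" "1 \<le> j" "j \<le> 3" "1 \<le> k" "k \<le> int n"
  shows "(j, k) \<in> A \<or> (j, k) \<in> B \<or> (j, k) \<in> C"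
proof -
  have "(j, k) \<in> rect n" using assms by (simp add: mem_rect)
  then show ?thesis using assms(1) unfolding tri_def by blast
qed

text \<open>A district that meets the first and the last column has exactly one cell in each column, so
  connectedness keeps it in one row.\<close>

lemma row_if_meets_both_ends:
  assumes S: "S \<subseteq> rect n" "card S = n" "grid_connected S" and n: "n > 0"
    and e: "(j, 1) \<in> S" "(j', int n) \<in> S"
  shows "S = row n j \<and> j \<in> {1..3}"
proof -
  have ge: "1 \<le> col_count S k" if k: "1 \<le> k" "k \<le> int n" for k
  proof -
    have "k = 1 \<or> k = int n \<or> 1 < k \<and> k < int n" using k by linarith
    then have "\<exists>i. (i, k) \<in> S" using e col_convex[OF S(3) e, of k] by blast
    then have "0 < col_count S k" by (simp add: col_count_pos_iff[OF S(1)])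
    then show ?thesis by simp
  qed
  have sum: "(\<Sum>k=1..int n. col_count S k) = int n" using district_profile[OF S] by blast
  have one: "col_count S k = 1" if k: "1 \<le> k" "k \<le> int n" for k
  proof (rule ccontr)
    assume "col_count S k \<noteq> 1"
    then have "1 < col_count S k" using ge[OF k] by simp
    then have "(\<Sum>k=1..int n. 1) < (\<Sum>k=1..int n. col_count S k)"
      by (intro sum_strict_mono_ex1) (use ge k in auto)
    then show False using sum by simp
  qed
  have uniq: "i = i'" if "(i, k) \<in> S" "(i', k) \<in> S" for i i' k
  proof -
    have "1 \<le> k" "k \<le> int n" using that S(1) by (auto simp: mem_rect)
    then have "card {i. (i, k) \<in> S} = 1" using one[of k] by (simp add: col_count_def)
    then obtain x where "{i. (i, k) \<in> S} = {x}" by (auto simp: card_1_singleton_iff)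
    then show ?thesis using that by (metis mem_Collect_eq singletonD)
  qed
  have "i = j" if "(i, k) \<in> S" for i k
    by (rule grid_connected_induct[OF S(3) e(1), where P = "\<lambda>i k. i = j"])
      (use that uniq in \<open>auto dest: uniq\<close>)
  then have "S \<subseteq> row n j" using S(1) by (auto simp: row_def rectangle_def)
  then have "S = row n j" by (intro card_subset_eq) (auto simp: row_def S(2) card_cartesian_product)
  moreover have "j \<in> {1..3}" using e(1) S(1) by (auto simp: mem_rect)
  ultimately show ?thesis by blast
qed

lemma adjacent_in_column:
  assumes t: "tri n A B C" and i: "1 \<le> i" "i \<le> int n"
    and "0 < col_count A i" "0 < col_count B i" "col_count C i = 0"
  shows "\<exists>u\<in>A. \<exists>v\<in>B. grid_adj u v"
proof -
  have noC: "(j, i) \<notin> C" for j using assms(6) col_count_pos_iff[OF tri_subsets(3)[OF t], of i] by auto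
  obtain x y where xy: "(x, i) \<in> A" "(y, i) \<in> B"
    using assms(4,5) col_count_pos_iff[OF tri_subsets(1)[OF t]] col_count_pos_iff[OF tri_subsets(2)[OF t]]
    by blast
  have d: "A \<inter> B = {}" using t by (simp add: tri_def)
  have "x \<in> {1, 2, 3}" "y \<in> {1, 2, 3}" using xy tri_subsets[OF t] by (auto simp: rectangle_def)
  moreover have "(2, i) \<in> A \<or> (2, i) \<in> B" using tri_cell[OF t, of 2 i] i noC by simp
  moreover have "grid_adj (1, i) (2, i)" "grid_adj (2, i) (1, i)" "grid_adj (3, i) (2, i)" "grid_adj (2, i) (3, i)"
    by (simp_all add: grid_adj_def)
  ultimately show ?thesis using xy d by blast
qed

lemma left_districtI:
  assumes t: "tri n A B C"
    and l: "\<And>j. 1 \<le> j \<Longrightarrow> j \<le> 3 \<Longrightarrow> (j, 1) \<in> A" and r: "\<And>j. (j, int n) \<notin> A"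
    and adj: "\<exists>u\<in>B. \<exists>v\<in>C. grid_adj u v"
  shows "left_district n A"
proof
  have "rect n - A = B \<union> C" using t unfolding tri_def by blast
  moreover have "grid_connected B" "grid_connected C" using t by (simp_all add: tri_def)
  ultimately show "grid_connected (rect n - A)" using adj grid_connected_Un by metis
  show "grid_connected A" using t by (simp add: tri_def)
qed (use tri_subsets[OF t] l r in auto)

text \<open>The other two districts both meet the last column: they are adjacent there, and \<open>A\<close> is not
  blocked.\<close>

lemma reach_if_two_at_right:
  assumes t: "tri n A B C"
    and l: "\<And>j. 1 \<le> j \<Longrightarrow> j \<le> 3 \<Longrightarrow> (j, 1) \<in> A" and r: "\<And>j. (j, int n) \<notin> A"
    and e: "(x, int n) \<in> B" "(y, int n) \<in> C"
  shows "reach n {A, B, C} (rows n)"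
proof -
  note s = tri_subsets[OF t]
  have n1: "1 \<le> int n" using e s by (auto simp: mem_rect)
  have pos: "0 < col_count B (int n)" "0 < col_count C (int n)"
    using e col_count_pos_iff[OF s(2)] col_count_pos_iff[OF s(3)] by blast+
  have "col_count A (int n) = 0" using r by (simp add: col_count_def)
  with adjacent_in_column[OF tri_perm(2)[OF tri_perm(3)[OF t]], of "int n"] n1 pos
  have adj: "\<exists>u\<in>B. \<exists>v\<in>C. grid_adj u v" by simp
  interpret left_district n A by (rule left_districtI[OF t l r adj])
  have "\<not> blocked A n"
    using not_blocked_if_two_at_right[OF tri_profile[OF t]] pos unfolding blocked_def by blast
  then show ?thesis using straight_or_blocked[OF t] by blast
qed

text \<open>The districts \<open>A\<close> and \<open>C\<close> own the first and the last column. If \<open>A\<close> is blocked, then it is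
  adjacent to \<open>B\<close>, so that \<open>C\<close> can be treated like \<open>A\<close> after reversing the columns; and \<open>C\<close> is
  not blocked as well.\<close>

lemma reach_if_one_at_each_end:
  assumes t: "tri n A B C"
    and l: "\<And>j. 1 \<le> j \<Longrightarrow> j \<le> 3 \<Longrightarrow> (j, 1) \<in> A"
    and r: "\<And>j. 1 \<le> j \<Longrightarrow> j \<le> 3 \<Longrightarrow> (j, int n) \<in> C"
    and adj: "\<exists>u\<in>B. \<exists>v\<in>C. grid_adj u v"
  shows "reach n {A, B, C} (rows n)"
proof (rule ccontr)
  assume nr: "\<not> ?thesis"
  note s = tri_subsets[OF t] and p = tri_profile[OF t]
  have d: "A \<inter> C = {}" using t by (simp add: tri_def)
  have rA: "(j, int n) \<notin> A" for j
  proof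
    assume a: "(j, int n) \<in> A"
    then have "1 \<le> j" "j \<le> 3" using s(1) mem_rect by blast+
    from r[OF this] a d show False by blast
  qed
  have lC: "(j, 1) \<notin> C" for j
  proof
    assume a: "(j, 1) \<in> C"
    then have "1 \<le> j" "j \<le> 3" using s(3) mem_rect by blast+
    from l[OF this] a d show False by blast
  qed
  have A1: "col_count A 1 = 3" by (rule col_count_3[OF s(1) l])
  have CN: "col_count C (int n) = 3" by (rule col_count_3[OF s(3) r])
  interpret L: left_district n A by (rule left_districtI[OF t l rA adj])
  have "blocked A n" using L.straight_or_blocked[OF t] nr by blast
  then obtain k where k: "1 \<le> k" "k \<le> int n" "col_count A k = 2"
    "(\<Sum>i=1..k. col_count A i) < 2 * k" unfolding blocked_def by blast
  obtain i where "1 \<le> i" "i \<le> int n" "0 < col_count A i" "0 < col_count B i" "col_count C i = 0"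
    using blocked_imp_common_column[OF p k A1] CN by auto
  from adjacent_in_column[OF t this]
  have "\<exists>u\<in>B. \<exists>v\<in>A. grid_adj u v" using grid_adj_sym by blast
  then have adj': "\<exists>u\<in>hflip n ` B. \<exists>v\<in>hflip n ` A. grid_adj u v"
    using rect_symmetry_hflip[of n] unfolding rect_symmetry_def by blast
  have t': "tri n (hflip n ` C) (hflip n ` B) (hflip n ` A)"
    by (rule symmetry_tri[OF rect_symmetry_hflip tri_perm(3)[OF t]])
  interpret R: left_district n "hflip n ` C"
    by (rule left_districtI[OF t' _ _ adj']) (use r lC in \<open>auto simp: mem_hflip\<close>)
  have "\<not> reach n {hflip n ` C, hflip n ` B, hflip n ` A} (rows n)"
    using reach_rows_hflip[of n C B A] nr by (auto simp: insert_commute)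
  then have "blocked (hflip n ` C) n" using R.straight_or_blocked[OF t'] by blast
  then obtain l where l: "1 \<le> l" "l \<le> int n" "col_count C (int n + 1 - l) = 2"
    "(\<Sum>i=1..l. col_count C (int n + 1 - i)) < 2 * l"
    unfolding blocked_def col_count_hflip by blast
  show False
    by (rule not_both_blocked[OF p A1 CN k, of "int n + 1 - l"])
      (use l in \<open>auto simp: sum_reverse_int\<close>)
qed

lemma grid_connected_rect:
  assumes "n > 0" shows "grid_connected (rect n)"
proof -
  have "grid_connected (row n 1 \<union> row n 2)"
    by (rule grid_connected_Un[of _ _ "(1, 1)" "(2, 1)"])
      (use assms in \<open>auto simp: grid_connected_row_n grid_adj_def\<close>, auto simp: row_def)
  then have "grid_connected (row n 1 \<union> row n 2 \<union> row n 3)"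
    by (rule grid_connected_Un[of _ _ "(2, 1)" "(3, 1)"])
      (use assms in \<open>auto simp: grid_connected_row_n grid_adj_def\<close>, auto simp: row_def)
  moreover have "row n 1 \<union> row n 2 \<union> row n 3 = rect n"
    using tri_rows[OF assms] by (simp add: tri_def)
  ultimately show ?thesis by simp
qed

lemma middle_adjacent:
  assumes t: "tri n A B C" and n: "n > 0"
  shows "(\<exists>u\<in>B. \<exists>v\<in>C. grid_adj u v) \<or> (\<exists>u\<in>B. \<exists>v\<in>A. grid_adj u v)"
proof (rule ccontr)
  assume nt: "\<not> ?thesis"
  have "rect n \<subseteq> B \<or> rect n \<subseteq> A \<union> C"
    by (rule grid_connected_subset_union[OF grid_connected_rect[OF n]])
      (use nt t in \<open>auto simp: tri_def\<close>)
  moreover have "A \<noteq> {}" "B \<noteq> {}" using t by (auto simp: tri_def grid_connected_def)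
  ultimately show False using t unfolding tri_def by blast
qed

lemma reach_if_left_column:
  assumes t: "tri n A B C" and n: "n > 0"
    and l: "\<And>j. 1 \<le> j \<Longrightarrow> j \<le> 3 \<Longrightarrow> (j, 1) \<in> A" and r: "\<And>j. (j, int n) \<notin> A"
  shows "reach n {A, B, C} (rows n)"
proof -
  have one: "reach n {A, B, C} (rows n)" if t: "tri n A B C" and b: "\<And>j. (j, int n) \<notin> B" for B C
  proof -
    have rC: "(j, int n) \<in> C" if "1 \<le> j" "j \<le> 3" for j
      using tri_cell[OF t that, of "int n"] n b r by auto
    show ?thesis
    proof (cases "\<exists>u\<in>B. \<exists>v\<in>C. grid_adj u v")
      case True
      show ?thesis by (rule reach_if_one_at_each_end[OF t l rC True])
    next
      case False
      then have "\<exists>u\<in>B. \<exists>v\<in>A. grid_adj u v" using middle_adjacent[OF t n] by blast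
      then have adj: "\<exists>u\<in>hflip n ` B. \<exists>v\<in>hflip n ` A. grid_adj u v"
        using rect_symmetry_hflip[of n] unfolding rect_symmetry_def by blast
      have t': "tri n (hflip n ` C) (hflip n ` B) (hflip n ` A)"
        by (rule symmetry_tri[OF rect_symmetry_hflip tri_perm(3)[OF t]])
      have "reach n {hflip n ` C, hflip n ` B, hflip n ` A} (rows n)"
        by (rule reach_if_one_at_each_end[OF t' _ _ adj]) (use l rC in \<open>auto simp: mem_hflip\<close>)
      from reach_rows_hflip[OF this] show ?thesis by (simp add: insert_commute)
    qed
  qed
  consider x y where "(x, int n) \<in> B" "(y, int n) \<in> C" | "\<And>j. (j, int n) \<notin> B" | "\<And>j. (j, int n) \<notin> C"
    by blast
  then show ?thesis
  proof cases
    case 1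
    show ?thesis by (rule reach_if_two_at_right[OF t l r 1])
  next
    case 2
    then show ?thesis by (rule one[OF t])
  next
    case 3
    from one[OF tri_perm(1)[OF t] this] show ?thesis by (simp add: insert_commute)
  qed
qed

text \<open>If no district meets both the first and the last column, then one of these two columns is
  contained in a single district, since there are only three districts.\<close>

lemma reach_rows:
  assumes P: "dmap n P" and n: "n > 0"
  shows "reach n P (rows n)"
proof -
  have "P \<noteq> {}" using P by (auto simp: districting_map_def)
  then obtain A where "A \<in> P" by blast
  then obtain B C where PE: "P = {A, B, C}" and t: "tri n A B C"
    by (rule dmap_triE[OF P])
  have d: "card D = n \<and> D \<subseteq> rect n \<and> grid_connected D" if "D \<in> {A, B, C}" for D
    using t tri_subsets[OF t] that unfolding tri_def by blast
  show ?thesis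
  proof (cases "\<exists>D\<in>{A, B, C}. \<exists>j j'. (j, 1) \<in> D \<and> (j', int n) \<in> D")
    case True
    then obtain D j j' where D: "D \<in> {A, B, C}" "(j, 1) \<in> D" "(j', int n) \<in> D" by blast
    then have "D = row n j" "j \<in> {1..3}" using row_if_meets_both_ends[of D n j j'] d[of D] n by auto
    with D(1) show ?thesis unfolding PE using reach_rows_if_row[OF t n] by blast
  next
    case False
    have disj: "(\<forall>j. (j, 1) \<notin> D) \<or> (\<forall>j. (j, int n) \<notin> D)" if "D \<in> {A, B, C}" for D
      using False that by blast
    have goal: "reach n {X, Y, Z} (rows n)"
      if t': "tri n X Y Z" and X: "X \<in> {A, B, C}" and Y: "\<And>j. (j, 1) \<notin> Y" and Z: "\<And>j. (j, 1) \<notin> Z"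
      for X Y Z
    proof (rule reach_if_left_column[OF t' n])
      show l: "(j, 1) \<in> X" if "1 \<le> j" "j \<le> 3" for j
        using tri_cell[OF t' that, of 1] n Y Z by simp
      show "(j, int n) \<notin> X" for j using disj[OF X] l[of 1] by auto
    qed
    have goal': "reach n {X, Y, Z} (rows n)"
      if t': "tri n X Y Z" and X: "X \<in> {A, B, C}"
        and Y: "\<And>j. (j, int n) \<notin> Y" and Z: "\<And>j. (j, int n) \<notin> Z"
      for X Y Z
    proof -
      have l: "(j, int n) \<in> X" if "1 \<le> j" "j \<le> 3" for j
        using tri_cell[OF t' that, of "int n"] n Y Z by simp
      have "(1, int n) \<in> X" by (rule l) simp_all
      then have "(j, 1) \<notin> X" for j using disj[OF X] by blast
      then have "reach n {hflip n ` X, hflip n ` Y, hflip n ` Z} (rows n)"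
        by (intro reach_if_left_column[OF symmetry_tri[OF rect_symmetry_hflip t'] n])
          (simp_all add: mem_hflip l)
      then show ?thesis by (rule reach_rows_hflip)
    qed
    have AB: "(\<forall>j. (j, 1) \<notin> A) \<or> (\<forall>j. (j, int n) \<notin> A)"
      "(\<forall>j. (j, 1) \<notin> B) \<or> (\<forall>j. (j, int n) \<notin> B)"
      "(\<forall>j. (j, 1) \<notin> C) \<or> (\<forall>j. (j, int n) \<notin> C)" by (rule disj; simp)+
    have A: "{A, B, C} = {A, C, B}" "{A, B, C} = {B, A, C}" "{A, B, C} = {C, B, A}" by auto
    consider "\<forall>j. (j, 1) \<notin> B" "\<forall>j. (j, 1) \<notin> C" | "\<forall>j. (j, 1) \<notin> A" "\<forall>j. (j, 1) \<notin> C"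
      | "\<forall>j. (j, 1) \<notin> B" "\<forall>j. (j, 1) \<notin> A"
      | "\<forall>j. (j, int n) \<notin> B" "\<forall>j. (j, int n) \<notin> C" | "\<forall>j. (j, int n) \<notin> A" "\<forall>j. (j, int n) \<notin> C"
      | "\<forall>j. (j, int n) \<notin> B" "\<forall>j. (j, int n) \<notin> A"
      using AB by metis
    then show ?thesis
    proof cases
      case 1 then show ?thesis using goal[OF t] PE by simp
    next
      case 2 then show ?thesis using goal[OF tri_perm(2)[OF t]] PE A(2) by simp
    next
      case 3 then show ?thesis using goal[OF tri_perm(3)[OF t]] PE A(3) by simp
    next
      case 4 then show ?thesis using goal'[OF t] PE by simp
    next
      case 5 then show ?thesis using goal'[OF tri_perm(2)[OF t]] PE A(2) by simp
    next
      case 6 then show ?thesis using goal'[OF tri_perm(3)[OF t]] PE A(3) by simp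
    qed
  qed
qed

theorem theorem3:
  fixes n :: nat
  assumes "n > 0"
  shows "Digraph_Component.connected (with_proj (metagraph (rectangle_graph 3 n) 3 n))"
  using connected_metagraph_if_reach[OF dmap_rows[OF assms]] reach_rows[OF _ assms] by blast

end
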